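(* Let $\Gamma$ be a connected locally finite graph with vertex set $V$, considered as the coarse space $(V,\mathcal{E}_d)$, where $d$ is the path metric on $V$. Then the following statements are equivalent: (i) $\Gamma$ admits a finitary selector; (ii) $\Gamma$ admits a 2-selector; (iii) $\Gamma$ is either finite or coarsely equivalent to $\mathbb{N}$ or $\mathbb{Z}$.
   Context: A coarse structure on a set $X$ is a family $\mathcal{E}$ of subsets of $X\times X$ (called entourages) such that: each $E\in\mathcal{E}$ contains the diagonal $\triangle_X=\{(x,x):x\in X\}$; if $E,E'\in\mathcal{E}$ then $E\circ E'=\{(x,y):\exists z\ ((x,z)\in E,\ (z,y)\in E')\}\in\mathcal{E}$ and $E^{-1}=\{(y,x):(x,y)\in E\}\in\mathcal{E}$; and if $E\in\mathcal{E}$ and $\triangle_X\subseteq E'\subseteq E$ then $E'\in\mathcal{E}$. The pair $(X,\mathcal{E})$ is a coarse space. For $x\in X$, $Y\subseteq X$, $E\in\mathcal{E}$ put $E[x]=\{y\in X:(x,y)\in E\}$ and $E[Y]=\bigcup_{y\in Y}E[y]$. A subfamily $\mathcal{E}'\subseteq\mathcal{E}$ is a base of $\mathcal{E}$ if each $E\in\mathcal{E}$ is contained in some $E'\in\mathcal{E}'$. A subset $Y\subseteq X$ inherits the subspace coarse structure $\{E\cap(Y\times Y):E\in\mathcal{E}\}$; $Y$ is large if $X=E[Y]$ for some $E\in\mathcal{E}$; $Y$ is bounded if $Y\subseteq E[x]$ for some $E\in\mathcal{E}$, $x\in X$. A map $f:X\to X'$ between coarse spaces $(X,\mathcal{E})$,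 $(X',\mathcal{E}')$ is macro-uniform if for every $E\in\mathcal{E}$ there is $E'\in\mathcal{E}'$ such that $f(E[x])\subseteq E'[f(x)]$ for each $x\in X$. An asymorphism is a bijection $f$ such that $f$ and $f^{-1}$ are macro-uniform. Two coarse spaces are coarsely equivalent if they contain large subspaces that are asymorphic to each other. Hyperballean: $\exp X$ is the set of all non-empty subsets of $X$, endowed with the coarse structure $\exp\mathcal{E}$ with base $\{\exp E:E\in\mathcal{E}\}$, where $(A,B)\in\exp E$ iff $A\subseteq E[B]$ and $B\subseteq E[A]$. For a non-empty subspace $\mathcal{F}$ of $\exp X$ (with the subspace coarse structure), an $\mathcal{F}$-selector of $(X,\mathcal{E})$ is a macro-uniform map $f:\mathcal{F}\to X$ with $f(A)\in A$ for each $A\in\mathcal{F}$. A 2-selector is an $\mathcal{F}$-selector for $\mathcal{F}=[X]^2$, the set of all two-element subsets of $X$. A metric $d$ on $X$ defines the coarse structure $\mathcal{E}_d$ with base $\{\{(x,y):d(x,y)\le r\}:r>0\}$. A connected graph $\Gamma$ with vertex set $V$ is regarded as the coarse space $(V,\mathcal{E}_d)$ with $d$ the path metric. $\Gamma$ is locally finite if $\{y\in V:d(x,y)\le 1\}$ is finite for each $x\in V$. A finitary selector of a locally finite connected graph is an $\mathcal{F}$-selector where $\mathcal{F}$ is the set of all non-empty bounded (equivalently, non-empty finite) subsets of $V$. $\mathbb{N}$ and $\mathbb{Z}$ denote the graphs on the natural numbers and on the integers, respectively, in which $a,b$ are adjacent iff $|a-b|=1$. *)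

theory Defs
  imports "HOL-Analysis.Analysis"
begin

section \<open>Coarse spaces\<close>

text \<open>
  A coarse space is given by a carrier \<open>X\<close> and a family \<open>\<E>\<close> of entourages, which are subsets of
  \<open>X \<times> X\<close>.  The ball \<open>E[x]\<close> is \<open>E `` {x}\<close> and \<open>E[Y]\<close> is \<open>E `` Y\<close>.
\<close>

definition coarse_structure :: "'a set \<Rightarrow> ('a \<times> 'a) set set \<Rightarrow> bool" where
  "coarse_structure X \<E> \<longleftrightarrow>
     (\<forall>E\<in>\<E>. Id_on X \<subseteq> E \<and> E \<subseteq> X \<times> X) \<and>
     (\<forall>E\<in>\<E>. \<forall>E'\<in>\<E>. E O E' \<in> \<E>) \<and>
     (\<forall>E\<in>\<E>. E\<inverse> \<in> \<E>) \<and>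
     (\<forall>E\<in>\<E>. \<forall>E'. Id_on X \<subseteq> E' \<and> E' \<subseteq> E \<longrightarrow> E' \<in> \<E>)"

text \<open>
  A coarse structure is determined by any of its bases \<open>\<B>\<close>: its entourages are exactly the sets
  between the diagonal and a member of \<open>\<B>\<close>.
\<close>

definition coarse_of_base :: "'a set \<Rightarrow> ('a \<times> 'a) set set \<Rightarrow> ('a \<times> 'a) set set" where
  "coarse_of_base X \<B> = {E. Id_on X \<subseteq> E \<and> (\<exists>B\<in>\<B>. E \<subseteq> B)}"

definition subspace_coarse :: "('a \<times> 'a) set set \<Rightarrow> 'a set \<Rightarrow> ('a \<times> 'a) set set" where
  "subspace_coarse \<E> Y = {E \<inter> (Y \<times> Y) | E. E \<in> \<E>}"

definition large :: "'a set \<Rightarrow> ('a \<times> 'a) set set \<Rightarrow> 'a set \<Rightarrow> bool" where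
  "large X \<E> Y \<longleftrightarrow> Y \<subseteq> X \<and> (\<exists>E\<in>\<E>. X = E `` Y)"

definition coarse_bounded :: "'a set \<Rightarrow> ('a \<times> 'a) set set \<Rightarrow> 'a set \<Rightarrow> bool" where
  "coarse_bounded X \<E> Y \<longleftrightarrow> Y \<subseteq> X \<and> (\<exists>E\<in>\<E>. \<exists>x\<in>X. Y \<subseteq> E `` {x})"

definition macro_uniform ::
  "'a set \<Rightarrow> ('a \<times> 'a) set set \<Rightarrow> 'b set \<Rightarrow> ('b \<times> 'b) set set \<Rightarrow> ('a \<Rightarrow> 'b) \<Rightarrow> bool" where
  "macro_uniform X \<E> X' \<E>' f \<longleftrightarrow>
     f \<in> X \<rightarrow> X' \<and> (\<forall>E\<in>\<E>. \<exists>E'\<in>\<E>'. \<forall>x\<in>X. f ` (E `` {x}) \<subseteq> E' `` {f x})"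

definition asymorphism ::
  "'a set \<Rightarrow> ('a \<times> 'a) set set \<Rightarrow> 'b set \<Rightarrow> ('b \<times> 'b) set set \<Rightarrow> ('a \<Rightarrow> 'b) \<Rightarrow> bool" where
  "asymorphism X \<E> X' \<E>' f \<longleftrightarrow>
     bij_betw f X X' \<and> macro_uniform X \<E> X' \<E>' f \<and> macro_uniform X' \<E>' X \<E> (inv_into X f)"

definition coarsely_equivalent ::
  "'a set \<Rightarrow> ('a \<times> 'a) set set \<Rightarrow> 'b set \<Rightarrow> ('b \<times> 'b) set set \<Rightarrow> bool" where
  "coarsely_equivalent X \<E> X' \<E>' \<longleftrightarrow>
     (\<exists>Y Y'. large X \<E> Y \<and> large X' \<E>' Y' \<and>
       (\<exists>f. asymorphism Y (subspace_coarse \<E> Y) Y' (subspace_coarse \<E>' Y') f))"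


section \<open>Hyperballeans and selectors\<close>

definition hyper :: "'a set \<Rightarrow> 'a set set" where
  "hyper X = {A. A \<subseteq> X \<and> A \<noteq> {}}"

definition hyper_entourage :: "'a set \<Rightarrow> ('a \<times> 'a) set \<Rightarrow> ('a set \<times> 'a set) set" where
  "hyper_entourage X E = {(A, B). A \<in> hyper X \<and> B \<in> hyper X \<and> A \<subseteq> E `` B \<and> B \<subseteq> E `` A}"

definition hyper_coarse :: "'a set \<Rightarrow> ('a \<times> 'a) set set \<Rightarrow> ('a set \<times> 'a set) set set" where
  "hyper_coarse X \<E> = coarse_of_base (hyper X) (hyper_entourage X ` \<E>)"

text \<open>
  The family \<open>\<F>\<close> may be empty.  This matters for a one-point space, which has no two-element
  subsets; its 2-selector is the empty map.
\<close>

definition selector ::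
  "'a set \<Rightarrow> ('a \<times> 'a) set set \<Rightarrow> 'a set set \<Rightarrow> ('a set \<Rightarrow> 'a) \<Rightarrow> bool" where
  "selector X \<E> \<F> f \<longleftrightarrow>
     macro_uniform \<F> (subspace_coarse (hyper_coarse X \<E>) \<F>) X \<E> f \<and> (\<forall>A\<in>\<F>. f A \<in> A)"

definition two_selector :: "'a set \<Rightarrow> ('a \<times> 'a) set set \<Rightarrow> ('a set \<Rightarrow> 'a) \<Rightarrow> bool" where
  "two_selector X \<E> f \<longleftrightarrow> selector X \<E> {A. A \<subseteq> X \<and> card A = 2} f"

definition finitary_selector :: "'a set \<Rightarrow> ('a \<times> 'a) set set \<Rightarrow> ('a set \<Rightarrow> 'a) \<Rightarrow> bool" where
  "finitary_selector X \<E> f \<longleftrightarrow> selector X \<E> {A. A \<noteq> {} \<and> coarse_bounded X \<E> A} f"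


section \<open>Metric spaces and graphs as coarse spaces\<close>

definition metric_coarse :: "'a set \<Rightarrow> ('a \<Rightarrow> 'a \<Rightarrow> real) \<Rightarrow> ('a \<times> 'a) set set" where
  "metric_coarse X d =
     coarse_of_base X {{(x, y). x \<in> X \<and> y \<in> X \<and> d x y \<le> r} | r. r > 0}"

text \<open>
  A simple graph, possibly infinite, with vertex set \<open>V\<close>; \<open>R\<close> is its adjacency relation.
\<close>

definition simple_graph :: "'v set \<Rightarrow> ('v \<times> 'v) set \<Rightarrow> bool" where
  "simple_graph V R \<longleftrightarrow> R \<subseteq> V \<times> V \<and> sym R \<and> irrefl R"

definition connected_graph :: "'v set \<Rightarrow> ('v \<times> 'v) set \<Rightarrow> bool" where
  "connected_graph V R \<longleftrightarrow> (\<forall>x\<in>V. \<forall>y\<in>V. (x, y) \<in> R\<^sup>*)"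

text \<open>
  \<open>(x, y) \<in> R ^^ n\<close> says that there is a walk with \<open>n\<close> edges from \<open>x\<close> to \<open>y\<close>; a shortest walk is
  a shortest path.  The value is arbitrary if \<open>x\<close> and \<open>y\<close> lie in different components.
\<close>

definition path_metric :: "('v \<times> 'v) set \<Rightarrow> 'v \<Rightarrow> 'v \<Rightarrow> real" where
  "path_metric R x y = real (LEAST n. (x, y) \<in> R ^^ n)"

definition locally_finite_graph :: "'v set \<Rightarrow> ('v \<times> 'v) set \<Rightarrow> bool" where
  "locally_finite_graph V R \<longleftrightarrow> (\<forall>x\<in>V. finite {y \<in> V. path_metric R x y \<le> 1})"

definition graph_coarse :: "'v set \<Rightarrow> ('v \<times> 'v) set \<Rightarrow> ('v \<times> 'v) set set" where
  "graph_coarse V R = metric_coarse V (path_metric R)"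

definition nat_adj :: "(nat \<times> nat) set" where
  "nat_adj = {(a, b). \<bar>int a - int b\<bar> = 1}"

definition int_adj :: "(int \<times> int) set" where
  "int_adj = {(a, b). \<bar>a - b\<bar> = 1}"


section \<open>Well-definedness\<close>

lemma Id_on_subset_relcomp:
  assumes "Id_on X \<subseteq> E" "Id_on X \<subseteq> F"
  shows "Id_on X \<subseteq> E O F"
  using assms by (auto simp: Id_on_def)

lemma coarse_structureD:
  assumes "coarse_structure X \<E>" and "E \<in> \<E>"
  shows "Id_on X \<subseteq> E" and "E \<subseteq> X \<times> X" and "E\<inverse> \<in> \<E>"
    and "E' \<in> \<E> \<Longrightarrow> E O E' \<in> \<E>"
    and "Id_on X \<subseteq> F \<Longrightarrow> F \<subseteq> E \<Longrightarrow> F \<in> \<E>"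
proof -
  have *: "\<forall>E\<in>\<E>. Id_on X \<subseteq> E \<and> E \<subseteq> X \<times> X" "\<forall>E\<in>\<E>. \<forall>E'\<in>\<E>. E O E' \<in> \<E>"
    "\<forall>E\<in>\<E>. E\<inverse> \<in> \<E>" "\<forall>E\<in>\<E>. \<forall>E'. Id_on X \<subseteq> E' \<and> E' \<subseteq> E \<longrightarrow> E' \<in> \<E>"
    using assms(1) unfolding coarse_structure_def by - (elim conjE, assumption)+
  show "Id_on X \<subseteq> E" using bspec[OF *(1) assms(2)] by (rule conjunct1)
  show "E \<subseteq> X \<times> X" using bspec[OF *(1) assms(2)] by (rule conjunct2)
  show "E\<inverse> \<in> \<E>" using *(3) assms(2) by (rule bspec)
  show "E O E' \<in> \<E>" if "E' \<in> \<E>" using bspec[OF *(2) assms(2)] that by (rule bspec)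
  show "F \<in> \<E>" if "Id_on X \<subseteq> F" "F \<subseteq> E" using bspec[OF *(4) assms(2)] that by iprover
qed

lemma coarse_structure_subspace:
  assumes "coarse_structure X \<E>" and "Y \<subseteq> X"
  shows "coarse_structure Y (subspace_coarse \<E> Y)"
proof -
  have sub: "F \<in> subspace_coarse \<E> Y"
    if "E \<in> \<E>" "Id_on Y \<subseteq> F" "F \<subseteq> E \<inter> (Y \<times> Y)" for E F
  proof -
    have "F \<union> Id_on X \<in> \<E>"
    proof (rule coarse_structureD(5)[OF assms(1) that(1)])
      show "F \<union> Id_on X \<subseteq> E" using coarse_structureD(1)[OF assms(1) that(1)] that(3) by simp
    qed simp
    moreover have "F = (F \<union> Id_on X) \<inter> (Y \<times> Y)"
      using that(2,3) by (auto simp: Id_on_def)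
    ultimately show ?thesis unfolding subspace_coarse_def by blast
  qed
  have diag: "Id_on Y \<subseteq> E" if "E \<in> \<E>" for E
    using coarse_structureD(1)[OF assms(1) that] assms(2) by (auto simp: Id_on_def)
  note comp = coarse_structureD(4)[OF assms(1)] and conv = coarse_structureD(3)[OF assms(1)]
  show ?thesis
    unfolding coarse_structure_def
  proof (intro conjI ballI allI impI)
    fix E assume "E \<in> subspace_coarse \<E> Y"
    then obtain E0 where E: "E0 \<in> \<E>" "E = E0 \<inter> (Y \<times> Y)" unfolding subspace_coarse_def by blast
    have dE: "Id_on Y \<subseteq> E" using diag[OF E(1)] E by (auto simp: Id_on_def)
    then show "Id_on Y \<subseteq> E" .
    show "E \<subseteq> Y \<times> Y" using E by blast
    show "E\<inverse> \<in> subspace_coarse \<E> Y"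
    proof (rule sub[OF conv[OF E(1)]])
      show "Id_on Y \<subseteq> E\<inverse>" using dE by auto
      show "E\<inverse> \<subseteq> E0\<inverse> \<inter> (Y \<times> Y)" using E(2) by blast
    qed
    {
      fix E' assume "E' \<in> subspace_coarse \<E> Y"
      then obtain E1 where E': "E1 \<in> \<E>" "E' = E1 \<inter> (Y \<times> Y)" unfolding subspace_coarse_def by blast
      have dE': "Id_on Y \<subseteq> E'" using diag[OF E'(1)] E' by (auto simp: Id_on_def)
      show "E O E' \<in> subspace_coarse \<E> Y"
      proof (rule sub[OF comp[OF E(1) E'(1)]])
        show "Id_on Y \<subseteq> E O E'" using dE dE' by (rule Id_on_subset_relcomp)
        show "E O E' \<subseteq> (E0 O E1) \<inter> (Y \<times> Y)" using E(2) E'(2) by blast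
      qed
    }
    fix E' assume "Id_on Y \<subseteq> E' \<and> E' \<subseteq> E"
    then show "E' \<in> subspace_coarse \<E> Y" using sub[OF E(1)] E(2) by blast
  qed
qed

lemma coarse_structure_of_base:
  assumes "\<And>B. B \<in> \<B> \<Longrightarrow> Id_on X \<subseteq> B \<and> B \<subseteq> X \<times> X"
    and "\<And>B C. B \<in> \<B> \<Longrightarrow> C \<in> \<B> \<Longrightarrow> \<exists>D\<in>\<B>. B O C \<subseteq> D"
    and "\<And>B. B \<in> \<B> \<Longrightarrow> \<exists>D\<in>\<B>. B\<inverse> \<subseteq> D"
  shows "coarse_structure X (coarse_of_base X \<B>)"
  unfolding coarse_structure_def
proof (intro conjI ballI allI impI)
  fix E assume "E \<in> coarse_of_base X \<B>"
  then obtain B where E: "Id_on X \<subseteq> E" "B \<in> \<B>" "E \<subseteq> B" unfolding coarse_of_base_def by blast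
  show "Id_on X \<subseteq> E" by fact
  show "E \<subseteq> X \<times> X" using E assms(1) by blast
  obtain D where "D \<in> \<B>" "B\<inverse> \<subseteq> D" using assms(3) E by blast
  moreover have "Id_on X \<subseteq> E\<inverse>" "E\<inverse> \<subseteq> B\<inverse>" using E by auto
  ultimately show "E\<inverse> \<in> coarse_of_base X \<B>" unfolding coarse_of_base_def by blast
  {
    fix E' assume "E' \<in> coarse_of_base X \<B>"
    then obtain C where E': "Id_on X \<subseteq> E'" "C \<in> \<B>" "E' \<subseteq> C" unfolding coarse_of_base_def by blast
    obtain D where "D \<in> \<B>" "B O C \<subseteq> D" using assms(2) E E' by blast
    moreover have "Id_on X \<subseteq> E O E'" using E E' by (intro Id_on_subset_relcomp)
    moreover have "E O E' \<subseteq> B O C" using E E' by auto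
    ultimately show "E O E' \<in> coarse_of_base X \<B>" unfolding coarse_of_base_def by blast
  }
  fix E' assume "Id_on X \<subseteq> E' \<and> E' \<subseteq> E"
  then show "E' \<in> coarse_of_base X \<B>" using E unfolding coarse_of_base_def by blast
qed

lemma coarse_structure_metric:
  assumes "Metric_space X d"
  shows "coarse_structure X (metric_coarse X d)"
  unfolding metric_coarse_def
proof (rule coarse_structure_of_base)
  interpret Metric_space X d by fact
  let ?U = "\<lambda>r. {(x, y). x \<in> X \<and> y \<in> X \<and> d x y \<le> r}"
  let ?B = "{?U r | r. r > 0}"
  fix B assume "B \<in> ?B"
  then obtain r where r: "r > 0" "B = ?U r" by blast
  show "Id_on X \<subseteq> B \<and> B \<subseteq> X \<times> X" using r by (auto simp: Id_on_def)
  show "\<exists>D\<in>?B. B\<inverse> \<subseteq> D"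
    using r by (intro bexI[of _ B]) (auto simp: commute)
  fix C assume "C \<in> ?B"
  then obtain s where s: "s > 0" "C = ?U s" by blast
  have "B O C \<subseteq> ?U (r + s)"
  proof -
    have "d x z \<le> r + s" if "x \<in> X" "y \<in> X" "z \<in> X" "d x y \<le> r" "d y z \<le> s" for x y z
      using triangle[OF that(1-3)] that by linarith
    then show ?thesis unfolding r s by blast
  qed
  moreover have "?U (r + s) \<in> ?B" using r s by force
  ultimately show "\<exists>D\<in>?B. B O C \<subseteq> D" by blast
qed

lemma coarse_structure_hyper:
  assumes "coarse_structure X \<E>"
  shows "coarse_structure (hyper X) (hyper_coarse X \<E>)"
  unfolding hyper_coarse_def
proof (rule coarse_structure_of_base)
  fix B assume "B \<in> hyper_entourage X ` \<E>"
  then obtain E where E: "E \<in> \<E>" "B = hyper_entourage X E" by blast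
  have dE: "Id_on X \<subseteq> E" "E \<subseteq> X \<times> X" using coarse_structureD(1,2)[OF assms E(1)] .
  show "Id_on (hyper X) \<subseteq> B \<and> B \<subseteq> hyper X \<times> hyper X"
    using dE(1) unfolding E hyper_entourage_def hyper_def by blast
  show "\<exists>D\<in>hyper_entourage X ` \<E>. B\<inverse> \<subseteq> D"
    using E by (intro bexI[of _ B]) (auto simp: hyper_entourage_def)
  fix C assume "C \<in> hyper_entourage X ` \<E>"
  then obtain F where F: "F \<in> \<E>" "C = hyper_entourage X F" by blast
  have dF: "Id_on X \<subseteq> F" "F \<subseteq> X \<times> X" using coarse_structureD(1,2)[OF assms F(1)] .
  define G where "G = (F O E) O (E O F)"
  have "G \<in> \<E>" unfolding G_def by (intro coarse_structureD(4)[OF assms] E(1) F(1))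
  have FE: "F O E \<subseteq> G" and EF: "E O F \<subseteq> G"
  proof -
    have diag: "(x, x) \<in> E" "(x, x) \<in> F" if "x \<in> X" for x using dE(1) dF(1) that by blast+
    show "F O E \<subseteq> G"
    proof (rule subrelI)
      fix x y assume xy: "(x, y) \<in> F O E"
      then have "y \<in> X" using dE(2) by blast
      then have "(y, y) \<in> E O F" using diag by blast
      with xy show "(x, y) \<in> G" unfolding G_def by (rule relcompI)
    qed
    show "E O F \<subseteq> G"
    proof (rule subrelI)
      fix x y assume xy: "(x, y) \<in> E O F"
      then have "x \<in> X" using dE(2) by blast
      then have "(x, x) \<in> F O E" using diag by blast
      then show "(x, y) \<in> G" unfolding G_def using xy by (rule relcompI)
    qed
  qed
  have "B O C \<subseteq> hyper_entourage X G"
  proof clarify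
    fix P Q R assume "(P, Q) \<in> B" "(Q, R) \<in> C"
    then have *: "P \<in> hyper X" "R \<in> hyper X" "P \<subseteq> E `` Q" "Q \<subseteq> E `` P" "Q \<subseteq> F `` R" "R \<subseteq> F `` Q"
      unfolding E(2) F(2) hyper_entourage_def by blast+
    have "P \<subseteq> (F O E) `` R" "R \<subseteq> (E O F) `` P" using * by blast+
    then have "P \<subseteq> G `` R" "R \<subseteq> G `` P" using FE EF by blast+
    then show "(P, R) \<in> hyper_entourage X G" using *(1,2) unfolding hyper_entourage_def by blast
  qed
  then show "\<exists>D\<in>hyper_entourage X ` \<E>. B O C \<subseteq> D" using \<open>G \<in> \<E>\<close> by blast
qed

lemma Metric_space_path_metric:
  assumes "simple_graph V R" and "connected_graph V R"
  shows "Metric_space V (path_metric R)"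
proof -
  have sym_pow: "(y, x) \<in> R ^^ n" if "(x, y) \<in> R ^^ n" for x y n
    using that
  proof (induction n arbitrary: y)
    case (Suc n)
    from Suc.prems obtain w where "(x, w) \<in> R ^^ n" "(w, y) \<in> R" by (rule relpow_Suc_E)
    then have "(w, x) \<in> R ^^ n" "(y, w) \<in> R"
      using Suc.IH assms(1) unfolding simple_graph_def by (blast dest: symD)+
    then show ?case using relpow_Suc_I2 by metis
  qed simp
  have least: "(x, y) \<in> R ^^ (LEAST n. (x, y) \<in> R ^^ n)" if "x \<in> V" "y \<in> V" for x y
    using assms(2) that unfolding connected_graph_def by (metis LeastI rtrancl_power)
  show ?thesis
  proof
    fix x y
    show "0 \<le> path_metric R x y" by (simp add: path_metric_def)
    have "(x, y) \<in> R ^^ n \<longleftrightarrow> (y, x) \<in> R ^^ n" for n using sym_pow by blast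
    then show "path_metric R x y = path_metric R y x" by (simp add: path_metric_def)
  next
    fix x y assume xy: "x \<in> V" "y \<in> V"
    show "path_metric R x y = 0 \<longleftrightarrow> x = y"
    proof
      assume "path_metric R x y = 0"
      then show "x = y" using least[OF xy] by (simp add: path_metric_def)
    next
      assume "x = y"
      then show "path_metric R x y = 0" by (simp add: path_metric_def Least_eq_0)
    qed
  next
    fix x y z assume xyz: "x \<in> V" "y \<in> V" "z \<in> V"
    let ?m = "LEAST n. (x, y) \<in> R ^^ n" and ?n = "LEAST n. (y, z) \<in> R ^^ n"
    have "(x, z) \<in> R ^^ (?m + ?n)"
      using least[OF xyz(1,2)] least[OF xyz(2,3)] unfolding relpow_add by blast
    then have "(LEAST n. (x, z) \<in> R ^^ n) \<le> ?m + ?n" by (rule Least_le)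
    then show "path_metric R x z \<le> path_metric R x y + path_metric R y z"
      unfolding path_metric_def by linarith
  qed
qed

end

theory Submission
  imports Defs
begin

text \<open>
  For a 2-selector \<open>f\<close>, let \<open>x\<close> precede \<open>y\<close> if \<open>f {x, y} = x\<close>. Macro-uniformity gives a constant \<open>C\<close>
  such that a point moving along a walk cannot change sides of \<open>z\<close> while staying at distance more
  than \<open>C\<close> from \<open>z\<close>. Hence if \<open>z\<close> lies between \<open>x\<close> and \<open>y\<close> in this order, then a geodesic from \<open>x\<close> to
  \<open>y\<close> passes within \<open>C\<close> of \<open>z\<close>, so \<open>d x z + d z y \<le> d x y + 2 C\<close>. It follows that the signed distance
  from a base point, with sign given by the order, is a coarse embedding into the integers. As the
  graph is connected, the image has bounded gaps; so it is finite or, up to sign, coarsely all of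
  \<open>\<nat>\<close> or \<open>\<int>\<close>. Conversely, given a coarse embedding \<open>h\<close> into the integers, choosing from each bounded
  set a point with the largest value of \<open>h\<close> is a finitary selector.
\<close>

section \<open>Metric coarse structures\<close>

text \<open>The radii \<open>r\<close> and \<open>s\<close> range over all reals, so no signs have
  to be tracked; where an actual entourage is needed they are replaced by a maximum with a
  nonnegative number.\<close>

definition bornologous_on :: "'a set \<Rightarrow> ('a \<Rightarrow> 'a \<Rightarrow> real) \<Rightarrow> ('b \<Rightarrow> 'b \<Rightarrow> real) \<Rightarrow> ('a \<Rightarrow> 'b) \<Rightarrow> bool" where
  "bornologous_on X d e f \<longleftrightarrow>
     (\<forall>r. \<exists>s. \<forall>x\<in>X. \<forall>y\<in>X. d x y \<le> r \<longrightarrow> e (f x) (f y) \<le> s)"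

text \<open>For a bijection this is \<open>bornologous_on\<close> for the inverse map. Together with
  \<open>bornologous_on\<close> it says that the map is a coarse embedding.\<close>

definition effectively_proper_on ::
  "'a set \<Rightarrow> ('a \<Rightarrow> 'a \<Rightarrow> real) \<Rightarrow> ('b \<Rightarrow> 'b \<Rightarrow> real) \<Rightarrow> ('a \<Rightarrow> 'b) \<Rightarrow> bool" where
  "effectively_proper_on X d e f \<longleftrightarrow>
     (\<forall>r. \<exists>s. \<forall>x\<in>X. \<forall>y\<in>X. e (f x) (f y) \<le> r \<longrightarrow> d x y \<le> s)"

lemma mem_metric_coarse_iff:
  "E \<in> metric_coarse X d \<longleftrightarrow>
     Id_on X \<subseteq> E \<and> E \<subseteq> X \<times> X \<and> (\<exists>r. \<forall>x y. (x, y) \<in> E \<longrightarrow> d x y \<le> r)"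
proof
  assume "E \<in> metric_coarse X d"
  then show "Id_on X \<subseteq> E \<and> E \<subseteq> X \<times> X \<and> (\<exists>r. \<forall>x y. (x, y) \<in> E \<longrightarrow> d x y \<le> r)"
    unfolding metric_coarse_def coarse_of_base_def by blast
next
  assume *: "Id_on X \<subseteq> E \<and> E \<subseteq> X \<times> X \<and> (\<exists>r. \<forall>x y. (x, y) \<in> E \<longrightarrow> d x y \<le> r)"
  then obtain r where r: "\<And>x y. (x, y) \<in> E \<Longrightarrow> d x y \<le> r" by blast
  \<comment> \<open>Radii in the base are strictly positive, while the bound \<open>r\<close> may be
    0 or negative.\<close>
  then have "E \<subseteq> {(x, y). x \<in> X \<and> y \<in> X \<and> d x y \<le> max r 1}" using * by fastforce
  moreover have "max r 1 > 0" by simp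
  ultimately show "E \<in> metric_coarse X d"
    unfolding metric_coarse_def coarse_of_base_def using * by blast
qed

text \<open>Nonnegativity of the radius puts the diagonal into the set. Later applications therefore
  take radii of the form \<open>max _ 0\<close>.\<close>

lemma (in Metric_space) ball_mem_metric_coarse:
  assumes "r \<ge> 0"
  shows "{(x, y). x \<in> M \<and> y \<in> M \<and> d x y \<le> r} \<in> metric_coarse M d"
  unfolding mem_metric_coarse_iff using assms by (auto simp: Id_on_def)

text \<open>To extend an entourage of \<open>Y\<close> to one of \<open>M\<close>, adjoin the
  diagonal of \<open>M\<close>. Intersecting with \<open>Y \<times> Y\<close> gives the original set
  back, since it already contains the diagonal of \<open>Y\<close>.\<close>

lemma (in Metric_space) metric_coarse_subspace:
  assumes "Y \<subseteq> M"
  shows "subspace_coarse (metric_coarse M d) Y = metric_coarse Y d"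
proof (rule set_eqI, rule iffI)
  fix E assume "E \<in> subspace_coarse (metric_coarse M d) Y"
  then obtain F where F: "F \<in> metric_coarse M d" "E = F \<inter> (Y \<times> Y)"
    unfolding subspace_coarse_def by blast
  then obtain r where "\<And>x y. (x, y) \<in> F \<Longrightarrow> d x y \<le> r"
    unfolding mem_metric_coarse_iff by blast
  moreover have "Id_on Y \<subseteq> E" "E \<subseteq> Y \<times> Y"
    using F assms unfolding mem_metric_coarse_iff by (auto simp: Id_on_def)
  ultimately show "E \<in> metric_coarse Y d"
    using F(2) unfolding mem_metric_coarse_iff by blast
next
  fix E assume E: "E \<in> metric_coarse Y d"
  then obtain r where r: "\<And>x y. (x, y) \<in> E \<Longrightarrow> d x y \<le> r"
    unfolding mem_metric_coarse_iff by blast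
  have "d x y \<le> max r 0" if "(x, y) \<in> E \<union> Id_on M" for x y
    using that r[of x y] by (auto simp: Id_on_def)
  then have "E \<union> Id_on M \<in> metric_coarse M d"
    using E assms unfolding mem_metric_coarse_iff by blast
  moreover have "E = (E \<union> Id_on M) \<inter> (Y \<times> Y)"
    using E unfolding mem_metric_coarse_iff by (auto simp: Id_on_def)
  ultimately show "E \<in> subspace_coarse (metric_coarse M d) Y"
    unfolding subspace_coarse_def by blast
qed

section \<open>Macro-uniform maps and selectors in terms of distances\<close>

lemma macro_uniform_metric_iff:
  assumes "Metric_space X d" "Metric_space X' e"
  shows "macro_uniform X (metric_coarse X d) X' (metric_coarse X' e) f \<longleftrightarrow>
    f \<in> X \<rightarrow> X' \<and> bornologous_on X d e f"
proof (intro iffI conjI; (elim conjE)?)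
  interpret X: Metric_space X d by fact
  interpret X': Metric_space X' e by fact
  {
    assume m: "macro_uniform X (metric_coarse X d) X' (metric_coarse X' e) f"
    then show "f \<in> X \<rightarrow> X'" unfolding macro_uniform_def by blast
    show "bornologous_on X d e f"
      unfolding bornologous_on_def
    proof
      fix r
      \<comment> \<open>This one entourage contains all pairs at distance at most \<open>r\<close>,
        so the entourage that controls its image bounds all of them at once.\<close>
      let ?E = "{(x, y). x \<in> X \<and> y \<in> X \<and> d x y \<le> max r 0}"
      have "?E \<in> metric_coarse X d" by (rule X.ball_mem_metric_coarse) simp
      then obtain E' where E': "E' \<in> metric_coarse X' e"
        "\<forall>x\<in>X. f ` (?E `` {x}) \<subseteq> E' `` {f x}"
        using m unfolding macro_uniform_def by blast
      then obtain s where s: "\<And>x y. (x, y) \<in> E' \<Longrightarrow> e x y \<le> s"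
        unfolding mem_metric_coarse_iff by blast
      have "e (f x) (f y) \<le> s" if "x \<in> X" "y \<in> X" "d x y \<le> r" for x y
      proof (rule s)
        have "f y \<in> f ` (?E `` {x})" using that by fastforce
        then show "(f x, f y) \<in> E'" using E'(2) that(1) by blast
      qed
      then show "\<exists>s. \<forall>x\<in>X. \<forall>y\<in>X. d x y \<le> r \<longrightarrow> e (f x) (f y) \<le> s" by blast
    qed
  next
    assume f: "f \<in> X \<rightarrow> X'" and b: "bornologous_on X d e f"
    show "macro_uniform X (metric_coarse X d) X' (metric_coarse X' e) f"
      unfolding macro_uniform_def
    proof (intro conjI ballI f)
      fix E assume E: "E \<in> metric_coarse X d"
      then obtain r where r: "\<And>x y. (x, y) \<in> E \<Longrightarrow> d x y \<le> r"
        unfolding mem_metric_coarse_iff by blast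
      obtain s where s: "\<And>x y. x \<in> X \<Longrightarrow> y \<in> X \<Longrightarrow> d x y \<le> r \<Longrightarrow> e (f x) (f y) \<le> s"
        using b unfolding bornologous_on_def by blast
      let ?E' = "{(x, y). x \<in> X' \<and> y \<in> X' \<and> e x y \<le> max s 0}"
      have "f ` (E `` {x}) \<subseteq> ?E' `` {f x}" if "x \<in> X" for x
      proof (rule image_subsetI)
        fix y assume "y \<in> E `` {x}"
        then have xy: "(x, y) \<in> E" by blast
        then have "y \<in> X" using E unfolding mem_metric_coarse_iff by blast
        then show "f y \<in> ?E' `` {f x}" using s[OF that _ r[OF xy]] f that by auto
      qed
      moreover have "?E' \<in> metric_coarse X' e" by (rule X'.ball_mem_metric_coarse) simp
      ultimately show "\<exists>E'\<in>metric_coarse X' e. \<forall>x\<in>X. f ` (E `` {x}) \<subseteq> E' `` {f x}"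
        by (intro bexI[of _ ?E'] ballI)
    qed
  }
qed

text \<open>The condition on \<open>A\<close> and \<open>B\<close> is Hausdorff closeness. Hausdorff
  distance can be infinite, or 0 between distinct sets, so the hyperballean is not a metric space
  and \<open>macro_uniform_metric_iff\<close> does not apply; the entourages are unfolded
  instead.\<close>

lemma (in Metric_space) selector_metric_iff:
  assumes "\<F> \<subseteq> hyper M"
  shows "selector M (metric_coarse M d) \<F> f \<longleftrightarrow>
    (\<forall>A\<in>\<F>. f A \<in> A) \<and>
    (\<forall>r. \<exists>s. \<forall>A\<in>\<F>. \<forall>B\<in>\<F>.
      (\<forall>a\<in>A. \<exists>b\<in>B. d a b \<le> r) \<and> (\<forall>b\<in>B. \<exists>a\<in>A. d a b \<le> r) \<longrightarrow> d (f A) (f B) \<le> s)"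
    (is "_ \<longleftrightarrow> _ \<and> (\<forall>r. \<exists>s. \<forall>A\<in>\<F>. \<forall>B\<in>\<F>. ?H A B r \<longrightarrow> _ A B s)")
proof (intro iffI conjI; (elim conjE)?)
  let ?E = "\<lambda>r. {(x, y). x \<in> M \<and> y \<in> M \<and> d x y \<le> r}"
  have sub: "A \<subseteq> M" if "A \<in> \<F>" for A using assms that unfolding hyper_def by blast
  {
    assume sel: "selector M (metric_coarse M d) \<F> f"
    then show "\<forall>A\<in>\<F>. f A \<in> A" unfolding selector_def by blast
    show "\<forall>r. \<exists>s. \<forall>A\<in>\<F>. \<forall>B\<in>\<F>. ?H A B r \<longrightarrow> d (f A) (f B) \<le> s"
    proof
      fix r
      have E: "?E (max r 0) \<in> metric_coarse M d" by (rule ball_mem_metric_coarse) simp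
      have "A \<subseteq> ?E (max r 0) `` A" if "A \<subseteq> M" for A
        using that by (intro subsetI ImageI) auto
      then have "Id_on (hyper M) \<subseteq> hyper_entourage M (?E (max r 0))"
        unfolding hyper_entourage_def hyper_def by (auto simp: Id_on_def simp del: max_def)
      then have "hyper_entourage M (?E (max r 0)) \<in> hyper_coarse M (metric_coarse M d)"
        unfolding hyper_coarse_def coarse_of_base_def using E by blast
      then have "hyper_entourage M (?E (max r 0)) \<inter> (\<F> \<times> \<F>)
          \<in> subspace_coarse (hyper_coarse M (metric_coarse M d)) \<F>"
        unfolding subspace_coarse_def by blast
      moreover have "\<forall>E\<in>subspace_coarse (hyper_coarse M (metric_coarse M d)) \<F>.
          \<exists>E'\<in>metric_coarse M d. \<forall>A\<in>\<F>. f ` (E `` {A}) \<subseteq> E' `` {f A}"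
        using sel unfolding selector_def macro_uniform_def by (elim conjE)
      ultimately have "\<exists>E'\<in>metric_coarse M d.
          \<forall>A\<in>\<F>. f ` ((hyper_entourage M (?E (max r 0)) \<inter> (\<F> \<times> \<F>)) `` {A}) \<subseteq> E' `` {f A}"
        by (rule bspec[rotated])
      then obtain E' where E': "E' \<in> metric_coarse M d"
        "\<forall>A\<in>\<F>. f ` ((hyper_entourage M (?E (max r 0)) \<inter> (\<F> \<times> \<F>)) `` {A}) \<subseteq> E' `` {f A}"
        by (rule bexE)
      then obtain s where s: "\<And>x y. (x, y) \<in> E' \<Longrightarrow> d x y \<le> s"
        unfolding mem_metric_coarse_iff by blast
      have bound: "d (f A) (f B) \<le> s" if AB: "A \<in> \<F>" "B \<in> \<F>" and H: "?H A B r" for A B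
      proof (rule s)
        have "A \<subseteq> ?E (max r 0) `` B"
        proof
          fix a assume a: "a \<in> A"
          then obtain b where "b \<in> B" "d a b \<le> r" using H by blast
          moreover from this have "(b, a) \<in> ?E (max r 0)"
            using a sub[OF AB(1)] sub[OF AB(2)] commute[of a b] by auto
          ultimately show "a \<in> ?E (max r 0) `` B" by blast
        qed
        moreover have "B \<subseteq> ?E (max r 0) `` A"
        proof
          fix b assume b: "b \<in> B"
          then obtain a where "a \<in> A" "d a b \<le> r" using H by blast
          moreover from this have "(a, b) \<in> ?E (max r 0)"
            using b sub[OF AB(1)] sub[OF AB(2)] by auto
          ultimately show "b \<in> ?E (max r 0) `` A" by blast
        qed
        ultimately have "(A, B) \<in> hyper_entourage M (?E (max r 0))"
          using AB assms unfolding hyper_entourage_def by blast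
        then show "(f A, f B) \<in> E'" using bspec[OF E'(2) AB(1)] AB by blast
      qed
      show "\<exists>s. \<forall>A\<in>\<F>. \<forall>B\<in>\<F>. ?H A B r \<longrightarrow> d (f A) (f B) \<le> s"
        by (intro exI[of _ s] ballI impI bound)
    qed
  next
    assume f: "\<forall>A\<in>\<F>. f A \<in> A"
      and u: "\<forall>r. \<exists>s. \<forall>A\<in>\<F>. \<forall>B\<in>\<F>. ?H A B r \<longrightarrow> d (f A) (f B) \<le> s"
    have fM: "f A \<in> M" if "A \<in> \<F>" for A using sub f that by blast
    show "selector M (metric_coarse M d) \<F> f"
      unfolding selector_def macro_uniform_def
    proof (intro conjI ballI)
      show "f \<in> \<F> \<rightarrow> M" using fM by blast
      show "f A \<in> A" if "A \<in> \<F>" for A using f that by blast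
      fix E assume "E \<in> subspace_coarse (hyper_coarse M (metric_coarse M d)) \<F>"
      then obtain F where F: "F \<in> metric_coarse M d" "E \<subseteq> hyper_entourage M F \<inter> (\<F> \<times> \<F>)"
        unfolding subspace_coarse_def hyper_coarse_def coarse_of_base_def by blast
      then obtain r where r: "\<And>x y. (x, y) \<in> F \<Longrightarrow> d x y \<le> r"
        unfolding mem_metric_coarse_iff by blast
      from spec[OF u, of r]
      obtain s where s: "\<forall>A\<in>\<F>. \<forall>B\<in>\<F>. ?H A B r \<longrightarrow> d (f A) (f B) \<le> s" by (rule exE)
      have "f ` (E `` {A}) \<subseteq> ?E (max s 0) `` {f A}" if A: "A \<in> \<F>" for A
      proof (rule image_subsetI)
        fix B assume "B \<in> E `` {A}"
        then have B: "B \<in> \<F>" and *: "A \<subseteq> F `` B" "B \<subseteq> F `` A"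
          using F(2) unfolding hyper_entourage_def by blast+
        have "\<exists>b\<in>B. d a b \<le> r" if a: "a \<in> A" for a
        proof -
          \<comment> \<open>The pair supplied here is directed from \<open>B\<close> to
            \<open>A\<close>. As \<open>F\<close> need not be symmetric, the symmetry of
            \<open>d\<close> is used to reverse it.\<close>
          from *(1) a obtain b where b: "b \<in> B" "(b, a) \<in> F" by blast
          moreover have "d a b \<le> r" using r[OF b(2)] by (simp only: commute[of a b])
          ultimately show ?thesis by blast
        qed
        moreover have "\<exists>a\<in>A. d a b \<le> r" if "b \<in> B" for b
          using *(2) that r by blast
        ultimately have "d (f A) (f B) \<le> s"
          by (intro mp[OF bspec[OF bspec[OF s A] B]] conjI ballI)
        then show "f B \<in> ?E (max s 0) `` {f A}" using fM A B by auto
      qed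
      moreover have "?E (max s 0) \<in> metric_coarse M d" by (rule ball_mem_metric_coarse) simp
      ultimately show "\<exists>E'\<in>metric_coarse M d. \<forall>A\<in>\<F>. f ` (E `` {A}) \<subseteq> E' `` {f A}"
        by (intro bexI[of _ "?E (max s 0)"] ballI)
    qed
  }
qed

text \<open>A coarse embedding with coarsely dense image need not be injective. Keeping one point of
  each fibre makes it a bijection onto its image, and both the set of kept points and the image are
  large.\<close>

lemma coarsely_equivalent_metricI:
  assumes "Metric_space X d" "Metric_space X' e" and f: "f \<in> X \<rightarrow> X'"
    and b: "bornologous_on X d e f" and p: "effectively_proper_on X d e f"
    and dense: "\<And>y. y \<in> X' \<Longrightarrow> \<exists>x\<in>X. e (f x) y \<le> K"
  shows "coarsely_equivalent X (metric_coarse X d) X' (metric_coarse X' e)"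
proof -
  interpret X: Metric_space X d by fact
  interpret X': Metric_space X' e by fact
  \<comment> \<open>\<open>Y\<close> is a transversal of the fibres of \<open>f\<close>.\<close>
  define Y where "Y = inv_into X f ` f ` X"
  define Y' where "Y' = f ` X"
  have Y: "Y \<subseteq> X" unfolding Y_def using inv_into_into[of _ f X] by blast
  have Y': "Y' \<subseteq> X'" unfolding Y'_def using f by blast
  have inv: "inv_into X f z \<in> Y" "f (inv_into X f z) = z" if "z \<in> Y'" for z
    using that unfolding Y_def Y'_def by (auto intro: f_inv_into_f)
  have bij: "bij_betw f Y Y'"
    unfolding bij_betw_def
  proof
    show "inj_on f Y"
      unfolding Y_def by (rule inj_onI) (auto simp: f_inv_into_f)
    show "f ` Y = Y'" using inv Y unfolding Y'_def by (metis image_eqI image_mono subsetI subset_antisym)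
  qed
  \<comment> \<open>Effective properness at radius 0 bounds the diameters of the fibres, so every
    point is within \<open>s\<close> of the representative in \<open>Y\<close>.\<close>
  obtain s where s: "\<And>x y. x \<in> X \<Longrightarrow> y \<in> X \<Longrightarrow> e (f x) (f y) \<le> 0 \<Longrightarrow> d x y \<le> s"
    using p unfolding effectively_proper_on_def by blast
  have "large X (metric_coarse X d) Y"
    unfolding large_def
  proof (intro conjI Y bexI)
    let ?E = "{(x, y). x \<in> X \<and> y \<in> X \<and> d x y \<le> max s 0}"
    show "?E \<in> metric_coarse X d" by (rule X.ball_mem_metric_coarse) simp
    have "x \<in> ?E `` Y" if x: "x \<in> X" for x
    proof -
      let ?y = "inv_into X f (f x)"
      have y: "?y \<in> Y" "f ?y = f x" using inv x unfolding Y'_def by blast+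
      then have "d ?y x \<le> s" using s x Y f by (metis X'.zero order_refl subsetD funcset_mem)
      then show ?thesis using y(1) x Y by auto
    qed
    then show "X = ?E `` Y" by auto
  qed
  moreover have "large X' (metric_coarse X' e) Y'"
    unfolding large_def
  proof (intro conjI Y' bexI)
    let ?E = "{(x, y). x \<in> X' \<and> y \<in> X' \<and> e x y \<le> max K 0}"
    show "?E \<in> metric_coarse X' e" by (rule X'.ball_mem_metric_coarse) simp
    have "y \<in> ?E `` Y'" if y: "y \<in> X'" for y
    proof -
      obtain x where "x \<in> X" "e (f x) y \<le> K" using dense[OF y] by blast
      then show ?thesis using y f unfolding Y'_def by (auto intro!: ImageI[of "f x"])
    qed
    then show "X' = ?E `` Y'" by auto
  qed
  moreover have "asymorphism Y (metric_coarse Y d) Y' (metric_coarse Y' e) f"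
    unfolding asymorphism_def
      macro_uniform_metric_iff[OF X.subspace[OF Y] X'.subspace[OF Y']]
      macro_uniform_metric_iff[OF X'.subspace[OF Y'] X.subspace[OF Y]]
  proof (intro conjI bij)
    show "f \<in> Y \<rightarrow> Y'" "inv_into Y f \<in> Y' \<rightarrow> Y"
      using bij bij_betw_inv_into[OF bij] by (auto simp: bij_betw_def)
    show "bornologous_on Y d e f"
      using b Y unfolding bornologous_on_def by (meson subsetD)
    show "bornologous_on Y' e d (inv_into Y f)"
      unfolding bornologous_on_def
    proof
      fix r
      obtain s where s: "\<And>x y. x \<in> X \<Longrightarrow> y \<in> X \<Longrightarrow> e (f x) (f y) \<le> r \<Longrightarrow> d x y \<le> s"
        using p unfolding effectively_proper_on_def by blast
      have "d (inv_into Y f x) (inv_into Y f y) \<le> s" if "x \<in> Y'" "y \<in> Y'" "e x y \<le> r" for x y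
      proof (rule s)
        show "inv_into Y f x \<in> X" "inv_into Y f y \<in> X"
          using bij_betw_inv_into[OF bij] that Y by (auto simp: bij_betw_def)
        show "e (f (inv_into Y f x)) (f (inv_into Y f y)) \<le> r"
          using that bij_betw_inv_into_right[OF bij] by simp
      qed
      then show "\<exists>s. \<forall>x\<in>Y'. \<forall>y\<in>Y'. e x y \<le> r \<longrightarrow> d (inv_into Y f x) (inv_into Y f y) \<le> s"
        by blast
    qed
  qed
  ultimately show ?thesis
    unfolding coarsely_equivalent_def
    using X.metric_coarse_subspace[OF Y] X'.metric_coarse_subspace[OF Y'] by metis
qed

text \<open>Largeness of \<open>Y\<close> gives a map \<open>q\<close> from \<open>X\<close> to
  \<open>Y\<close> that moves points by a bounded amount; its composition with the asymorphism
  \<open>g\<close> is a coarse embedding of all of \<open>X\<close>.\<close>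

lemma coarsely_equivalent_metricE:
  assumes "Metric_space X d" "Metric_space X' e"
    and "coarsely_equivalent X (metric_coarse X d) X' (metric_coarse X' e)"
  obtains f where "f \<in> X \<rightarrow> X'" "bornologous_on X d e f" "effectively_proper_on X d e f"
proof -
  interpret X: Metric_space X d by fact
  interpret X': Metric_space X' e by fact
  obtain Y Y' g where large: "large X (metric_coarse X d) Y" "large X' (metric_coarse X' e) Y'"
    and asym: "asymorphism Y (subspace_coarse (metric_coarse X d) Y)
      Y' (subspace_coarse (metric_coarse X' e) Y') g"
    using assms(3) unfolding coarsely_equivalent_def by blast
  have Y: "Y \<subseteq> X" and Y': "Y' \<subseteq> X'" using large unfolding large_def by blast+
  have g: "bij_betw g Y Y'" "g \<in> Y \<rightarrow> Y'" "bornologous_on Y d e g"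
    "bornologous_on Y' e d (inv_into Y g)"
    using asym unfolding asymorphism_def X.metric_coarse_subspace[OF Y]
      X'.metric_coarse_subspace[OF Y']
      macro_uniform_metric_iff[OF X.subspace[OF Y] X'.subspace[OF Y']]
      macro_uniform_metric_iff[OF X'.subspace[OF Y'] X.subspace[OF Y]] by blast+
  obtain E where E: "E \<in> metric_coarse X d" "X = E `` Y" using large(1) unfolding large_def by blast
  then obtain r where r: "\<And>x y. (x, y) \<in> E \<Longrightarrow> d x y \<le> r"
    unfolding mem_metric_coarse_iff by blast
  have "\<exists>y\<in>Y. d y x \<le> r" if "x \<in> X" for x using that E(2) r by blast
  then obtain q where q: "\<And>x. x \<in> X \<Longrightarrow> q x \<in> Y" "\<And>x. x \<in> X \<Longrightarrow> d (q x) x \<le> r" by metis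
  have qX: "q x \<in> X" if "x \<in> X" for x using q(1)[OF that] Y by blast
  \<comment> \<open>Replacing each of the two points by its image under \<open>q\<close> costs at
    most \<open>r\<close>.\<close>
  have near: "d (q x) (q y) \<le> d x y + 2 * r" "d x y \<le> d (q x) (q y) + 2 * r"
    if "x \<in> X" "y \<in> X" for x y
    using X.triangle[of "q x" x "q y"] X.triangle[of x y "q y"] X.triangle[of x "q x" y]
      X.triangle[of "q x" "q y" y] X.commute[of y "q y"] X.commute[of x "q x"]
      q(2)[OF that(1)] q(2)[OF that(2)] qX that by auto
  show ?thesis
  proof (rule that)
    show "g \<circ> q \<in> X \<rightarrow> X'" using g(2) q(1) Y' by fastforce
    show "bornologous_on X d e (g \<circ> q)"
      unfolding bornologous_on_def
    proof
      fix t
      obtain s where s: "\<And>x y. x \<in> Y \<Longrightarrow> y \<in> Y \<Longrightarrow> d x y \<le> t + 2 * r \<Longrightarrow> e (g x) (g y) \<le> s"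
        using g(3) unfolding bornologous_on_def by blast
      have "e ((g \<circ> q) x) ((g \<circ> q) y) \<le> s" if "x \<in> X" "y \<in> X" "d x y \<le> t" for x y
        using s[OF q(1) q(1)] near(1) that by fastforce
      then show "\<exists>s. \<forall>x\<in>X. \<forall>y\<in>X. d x y \<le> t \<longrightarrow> e ((g \<circ> q) x) ((g \<circ> q) y) \<le> s" by blast
    qed
    show "effectively_proper_on X d e (g \<circ> q)"
      unfolding effectively_proper_on_def
    proof
      fix t
      obtain s where s: "\<And>x y. x \<in> Y' \<Longrightarrow> y \<in> Y' \<Longrightarrow> e x y \<le> t \<Longrightarrow>
          d (inv_into Y g x) (inv_into Y g y) \<le> s"
        using g(4) unfolding bornologous_on_def by blast
      have "d x y \<le> s + 2 * r" if xy: "x \<in> X" "y \<in> X" and *: "e ((g \<circ> q) x) ((g \<circ> q) y) \<le> t" for x y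
      proof -
        have "inv_into Y g (g (q z)) = q z" if "z \<in> X" for z
          using bij_betw_inv_into_left[OF g(1)] q(1) that by blast
        moreover have "g (q z) \<in> Y'" if "z \<in> X" for z using g(2) q(1) that by blast
        ultimately have "d (q x) (q y) \<le> s" using s[of "g (q x)" "g (q y)"] xy * by simp
        then show ?thesis using near(2)[OF xy] by simp
      qed
      then show "\<exists>s. \<forall>x\<in>X. \<forall>y\<in>X. e ((g \<circ> q) x) ((g \<circ> q) y) \<le> t \<longrightarrow> d x y \<le> s" by blast
    qed
  qed
qed

section \<open>Path metrics\<close>

text \<open>Monotone walks attain this length, and no walk is shorter because each edge changes the
  vertex by 1.\<close>

lemma Least_relpow_nat_adj: "(LEAST n. (a, b) \<in> nat_adj ^^ n) = nat \<bar>int a - int b\<bar>"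
proof (rule Least_equality)
  have up: "(a, a + n) \<in> nat_adj ^^ n" for a n
  proof (induction n)
    case (Suc n)
    then show ?case by (auto simp: nat_adj_def intro!: relcompI[of a "a + n"])
  qed simp
  have down: "(a + n, a) \<in> nat_adj ^^ n" for a n
  proof (induction n)
    case (Suc n)
    then show ?case by (intro relpow_Suc_I2[of _ "a + n"]) (auto simp: nat_adj_def)
  qed simp
  show "(a, b) \<in> nat_adj ^^ nat \<bar>int a - int b\<bar>"
  proof (cases "a \<le> b")
    case True
    then have "nat \<bar>int a - int b\<bar> = b - a" "b = a + (b - a)" by auto
    then show ?thesis using up[of a "b - a"] by simp
  next
    case False
    then have "nat \<bar>int a - int b\<bar> = a - b" "a = b + (a - b)" by auto
    then show ?thesis using down[of b "a - b"] by simp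
  qed
  have "\<bar>int a - int c\<bar> \<le> int n" if "(a, c) \<in> nat_adj ^^ n" for c n
    using that
  proof (induction n arbitrary: c)
    case (Suc n)
    then show ?case by (fastforce simp: nat_adj_def)
  qed simp
  then show "nat \<bar>int a - int b\<bar> \<le> n" if "(a, b) \<in> nat_adj ^^ n" for n using that by fastforce
qed

lemma Least_relpow_int_adj: "(LEAST n. (a, b) \<in> int_adj ^^ n) = nat \<bar>a - b\<bar>"
proof (rule Least_equality)
  have up: "(a, a + int n) \<in> int_adj ^^ n" for a n
  proof (induction n)
    case (Suc n)
    then show ?case by (auto simp: int_adj_def intro!: relcompI[of a "a + int n"])
  qed simp
  have down: "(a + int n, a) \<in> int_adj ^^ n" for a n
  proof (induction n)
    case (Suc n)
    then show ?case by (intro relpow_Suc_I2[of _ "a + int n"]) (auto simp: int_adj_def)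
  qed simp
  show "(a, b) \<in> int_adj ^^ nat \<bar>a - b\<bar>"
    using up[of a "nat \<bar>a - b\<bar>"] down[of b "nat \<bar>a - b\<bar>"] by (cases "a \<le> b") auto
  have "\<bar>a - c\<bar> \<le> int n" if "(a, c) \<in> int_adj ^^ n" for c n
    using that
  proof (induction n arbitrary: c)
    case (Suc n)
    then show ?case by (fastforce simp: int_adj_def)
  qed simp
  then show "nat \<bar>a - b\<bar> \<le> n" if "(a, b) \<in> int_adj ^^ n" for n using that by fastforce
qed

lemma graph_coarse_nat: "graph_coarse UNIV nat_adj = metric_coarse UNIV (\<lambda>a b. \<bar>real a - real b\<bar>)"
proof -
  have "path_metric nat_adj a b = \<bar>real a - real b\<bar>" for a b
    unfolding path_metric_def Least_relpow_nat_adj by simp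
  then have "path_metric nat_adj = (\<lambda>a b. \<bar>real a - real b\<bar>)" by blast
  then show ?thesis unfolding graph_coarse_def by simp
qed

lemma graph_coarse_int: "graph_coarse UNIV int_adj = metric_coarse UNIV (\<lambda>a b. \<bar>of_int a - of_int b\<bar>)"
proof -
  have "path_metric int_adj a b = \<bar>of_int a - of_int b\<bar>" for a b
    unfolding path_metric_def Least_relpow_int_adj by simp
  then have "path_metric int_adj = (\<lambda>a b. \<bar>of_int a - of_int b\<bar>)" by blast
  then show ?thesis unfolding graph_coarse_def by simp
qed

lemma Metric_space_nat: "Metric_space (UNIV :: nat set) (\<lambda>a b. \<bar>real a - real b\<bar>)"
  by unfold_locales auto

lemma Metric_space_int: "Metric_space (UNIV :: int set) (\<lambda>a b. \<bar>of_int a - of_int b\<bar>)"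
  by unfold_locales auto

lemma path_metric_le_of_relpow: "(x, y) \<in> R ^^ n \<Longrightarrow> path_metric R x y \<le> real n"
  unfolding path_metric_def by (simp add: Least_le)

section \<open>Geodesics and finiteness of balls\<close>

lemma connected_graph_geodesic:
  assumes "connected_graph V R" "x \<in> V" "y \<in> V"
  obtains n where "(x, y) \<in> R ^^ n" "path_metric R x y = real n"
proof -
  have "\<exists>n. (x, y) \<in> R ^^ n"
    using assms unfolding connected_graph_def by (metis rtrancl_power)
  then have "(x, y) \<in> R ^^ (LEAST n. (x, y) \<in> R ^^ n)" by (rule LeastI_ex)
  then show thesis by (rule that) (simp add: path_metric_def)
qed

text \<open>By induction on \<open>n\<close>, only finitely many vertices are endpoints of walks
  with \<open>n\<close> edges from \<open>v\<close>, since the neighbours of a vertex lie in its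
  finite unit ball.\<close>

lemma locally_finite_graph_finite_ball:
  assumes "simple_graph V R" "connected_graph V R" "locally_finite_graph V R" "v \<in> V"
  shows "finite {x \<in> V. path_metric R v x \<le> r}"
proof -
  have RV: "R \<subseteq> V \<times> V" using assms(1) unfolding simple_graph_def by blast
  have fin: "finite {x. (v, x) \<in> R ^^ n}" for n
  proof (induction n)
    case (Suc n)
    have "finite {y. (x, y) \<in> R}" if "(v, x) \<in> R ^^ n" for x
    proof (cases "x \<in> V")
      case True
      have "{y. (x, y) \<in> R} \<subseteq> {y \<in> V. path_metric R x y \<le> 1}"
        using RV path_metric_le_of_relpow[where n = 1] by auto
      then show ?thesis
        using assms(3) True unfolding locally_finite_graph_def by (metis finite_subset)
    next
      case False
      then have "{y. (x, y) \<in> R} = {}" using RV by blast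
      then show ?thesis by simp
    qed
    moreover have "{x. (v, x) \<in> R ^^ Suc n} = (\<Union>x\<in>{x. (v, x) \<in> R ^^ n}. {y. (x, y) \<in> R})"
      by auto
    ultimately show ?case using Suc by simp
  qed simp
  \<comment> \<open>Distances are natural numbers, so a real radius can be rounded down.\<close>
  have "{x \<in> V. path_metric R v x \<le> r} \<subseteq> (\<Union>n\<le>nat \<lfloor>r\<rfloor>. {x. (v, x) \<in> R ^^ n})"
  proof clarify
    fix x assume x: "x \<in> V" "path_metric R v x \<le> r"
    obtain n where n: "(v, x) \<in> R ^^ n" "path_metric R v x = real n"
      using connected_graph_geodesic[OF assms(2,4) x(1)] .
    then have "n \<le> nat \<lfloor>r\<rfloor>" using x(2) by (simp add: le_nat_floor)
    then show "x \<in> (\<Union>n\<le>nat \<lfloor>r\<rfloor>. {x. (v, x) \<in> R ^^ n})" using n(1) by blast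
  qed
  then show ?thesis using fin by (meson finite_UN_I finite_atMost finite_subset)
qed

section \<open>Selectors from line-like spaces\<close>

lemma coarse_bounded_metric_iff:
  assumes "Metric_space X d"
  shows "coarse_bounded X (metric_coarse X d) A \<longleftrightarrow> A \<subseteq> X \<and> (\<exists>x\<in>X. \<exists>r. \<forall>a\<in>A. d x a \<le> r)"
proof
  assume "coarse_bounded X (metric_coarse X d) A"
  then obtain E x where E: "A \<subseteq> X" "E \<in> metric_coarse X d" "x \<in> X" "A \<subseteq> E `` {x}"
    unfolding coarse_bounded_def by blast
  then obtain r where "\<And>x y. (x, y) \<in> E \<Longrightarrow> d x y \<le> r"
    unfolding mem_metric_coarse_iff by blast
  then have "\<forall>a\<in>A. d x a \<le> r" using E(4) by blast
  then show "A \<subseteq> X \<and> (\<exists>x\<in>X. \<exists>r. \<forall>a\<in>A. d x a \<le> r)" using E(1,3) by blast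
next
  interpret Metric_space X d by fact
  assume A: "A \<subseteq> X \<and> (\<exists>x\<in>X. \<exists>r. \<forall>a\<in>A. d x a \<le> r)"
  then obtain x r where x: "x \<in> X" "\<And>a. a \<in> A \<Longrightarrow> d x a \<le> r" by blast
  let ?E = "{(x, y). x \<in> X \<and> y \<in> X \<and> d x y \<le> max r 0}"
  have "?E \<in> metric_coarse X d" by (rule ball_mem_metric_coarse) simp
  moreover have "A \<subseteq> ?E `` {x}" using A x by fastforce
  ultimately show "coarse_bounded X (metric_coarse X d) A"
    unfolding coarse_bounded_def using A x(1) by blast
qed

text \<open>Choose a point of \<open>A\<close> with the largest value of \<open>h\<close>. For
  Hausdorff-close sets these largest values are close because \<open>h\<close> is bornologous, and
  then the chosen points are close because \<open>h\<close> is effectively proper.\<close>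

lemma finitary_selector_if_embeds_int:
  fixes h :: "'a \<Rightarrow> int"
  assumes "Metric_space X d"
    and b: "bornologous_on X d (\<lambda>a b. \<bar>of_int a - of_int b\<bar>) h"
    and p: "effectively_proper_on X d (\<lambda>a b. \<bar>of_int a - of_int b\<bar>) h"
  shows "\<exists>f. finitary_selector X (metric_coarse X d) f"
proof -
  interpret Metric_space X d by fact
  let ?F = "{A. A \<noteq> {} \<and> coarse_bounded X (metric_coarse X d) A}"
  have sub: "A \<subseteq> X" if "A \<in> ?F" for A using that unfolding coarse_bounded_def by blast
  have "\<exists>a\<in>A. \<forall>a'\<in>A. h a' \<le> h a" if A: "A \<in> ?F" for A
  proof -
    obtain x r where x: "x \<in> X" "\<And>a. a \<in> A \<Longrightarrow> d x a \<le> r"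
      using A unfolding coarse_bounded_metric_iff[OF assms(1)] by blast
    obtain s where s: "\<And>x y. x \<in> X \<Longrightarrow> y \<in> X \<Longrightarrow> d x y \<le> r \<Longrightarrow> \<bar>of_int (h x) - of_int (h y)\<bar> \<le> (s :: real)"
      using b unfolding bornologous_on_def by blast
    \<comment> \<open>A bounded set \<open>A\<close> may be infinite here, but its image consists of
      integers in a bounded interval, so the maximum is attained.\<close>
    have "h ` A \<subseteq> {h x - \<lceil>s\<rceil> .. h x + \<lceil>s\<rceil>}"
    proof clarify
      fix a assume a: "a \<in> A"
      then have "\<bar>of_int (h x) - of_int (h a)\<bar> \<le> s" using s x sub[OF A] by blast
      then show "h a \<in> {h x - \<lceil>s\<rceil> .. h x + \<lceil>s\<rceil>}" unfolding atLeastAtMost_iff by linarith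
    qed
    then have fin: "finite (h ` A)" by (rule finite_subset) simp
    moreover have "h ` A \<noteq> {}" using A by blast
    ultimately have "Max (h ` A) \<in> h ` A" by (rule Max_in)
    then show ?thesis using fin by (metis (no_types, lifting) Max_ge imageE imageI)
  qed
  then obtain f where f: "\<And>A. A \<in> ?F \<Longrightarrow> f A \<in> A" "\<And>A a. A \<in> ?F \<Longrightarrow> a \<in> A \<Longrightarrow> h a \<le> h (f A)"
    by metis
  have "selector X (metric_coarse X d) ?F f"
  proof (subst selector_metric_iff)
    show "?F \<subseteq> hyper X" using sub unfolding hyper_def by blast
    show "(\<forall>A\<in>?F. f A \<in> A) \<and> (\<forall>r. \<exists>s. \<forall>A\<in>?F. \<forall>B\<in>?F.
      (\<forall>a\<in>A. \<exists>b\<in>B. d a b \<le> r) \<and> (\<forall>b\<in>B. \<exists>a\<in>A. d a b \<le> r) \<longrightarrow> d (f A) (f B) \<le> s)"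
    proof (intro conjI ballI allI f(1))
      fix r
      obtain s where s: "\<And>x y. x \<in> X \<Longrightarrow> y \<in> X \<Longrightarrow> d x y \<le> r \<Longrightarrow> \<bar>of_int (h x) - of_int (h y)\<bar> \<le> (s :: real)"
        using b unfolding bornologous_on_def by blast
      obtain t where t: "\<And>x y. x \<in> X \<Longrightarrow> y \<in> X \<Longrightarrow> \<bar>of_int (h x) - of_int (h y)\<bar> \<le> s \<Longrightarrow> d x y \<le> t"
        using p unfolding effectively_proper_on_def by blast
      have "d (f A) (f B) \<le> t" if A: "A \<in> ?F" and B: "B \<in> ?F"
        and H: "\<forall>a\<in>A. \<exists>b\<in>B. d a b \<le> r" "\<forall>b\<in>B. \<exists>a\<in>A. d a b \<le> r" for A B
      proof (rule t)
        show X: "f A \<in> X" "f B \<in> X" using f(1) sub A B by blast+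
        obtain b' where b': "b' \<in> B" "d (f A) b' \<le> r" using H(1) f(1)[OF A] by blast
        obtain a' where a': "a' \<in> A" "d a' (f B) \<le> r" using H(2) f(1)[OF B] by blast
        \<comment> \<open>A point \<open>b'\<close> of \<open>B\<close> near \<open>f A\<close> has
          value at most that of \<open>f B\<close>. Hence \<open>h (f A)\<close> exceeds
          \<open>h (f B)\<close> by at most \<open>s\<close>; the point \<open>a'\<close> gives the
          reverse estimate.\<close>
        have "\<bar>of_int (h (f A)) - of_int (h b')\<bar> \<le> s" "h b' \<le> h (f B)"
          using s[OF X(1) _ b'(2)] b'(1) sub[OF B] f(2)[OF B] by blast+
        moreover have "\<bar>of_int (h a') - of_int (h (f B))\<bar> \<le> s" "h a' \<le> h (f A)"
          using s[OF _ X(2) a'(2)] a'(1) sub[OF A] f(2)[OF A] by blast+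
        ultimately show "\<bar>of_int (h (f A)) - of_int (h (f B))\<bar> \<le> s" by linarith
      qed
      then show "\<exists>s. \<forall>A\<in>?F. \<forall>B\<in>?F.
        (\<forall>a\<in>A. \<exists>b\<in>B. d a b \<le> r) \<and> (\<forall>b\<in>B. \<exists>a\<in>A. d a b \<le> r) \<longrightarrow> d (f A) (f B) \<le> s"
        by blast
    qed
  qed
  then show ?thesis unfolding finitary_selector_def by blast
qed

text \<open>Pairs are bounded, and the metric criterion for selectors passes to subfamilies.\<close>

lemma two_selector_if_finitary_selector:
  assumes "Metric_space X d" "finitary_selector X (metric_coarse X d) f"
  shows "two_selector X (metric_coarse X d) f"
proof -
  interpret Metric_space X d by fact
  let ?F = "{A. A \<noteq> {} \<and> coarse_bounded X (metric_coarse X d) A}" and ?G = "{A. A \<subseteq> X \<and> card A = 2}"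
  have "coarse_bounded X (metric_coarse X d) A" if A: "A \<in> ?G" for A
  proof -
    obtain x y where "A = {x, y}" using A by (auto simp: card_2_iff)
    moreover have "\<forall>a\<in>{x, y}. d x a \<le> max (d x x) (d x y)" by auto
    ultimately show ?thesis
      unfolding coarse_bounded_metric_iff[OF assms(1)] using A by blast
  qed
  then have GF: "?G \<subseteq> ?F" by fastforce
  have F: "?F \<subseteq> hyper X" unfolding hyper_def coarse_bounded_def by blast
  then have G: "?G \<subseteq> hyper X" using GF by blast
  show ?thesis
    using assms(2) unfolding finitary_selector_def two_selector_def
      selector_metric_iff[OF F] selector_metric_iff[OF G]
    using GF by (meson subsetD)
qed

section \<open>Coordinates from 2-selectors\<close>

locale two_selector_graph =
  fixes V :: "'v set" and R :: "('v \<times> 'v) set" and f :: "'v set \<Rightarrow> 'v"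
  assumes graph: "simple_graph V R" and connected: "connected_graph V R"
    and two_sel: "two_selector V (graph_coarse V R) f"
begin

sublocale Metric_space V "path_metric R"
  using graph connected by (rule Metric_space_path_metric)

abbreviation d :: "'v \<Rightarrow> 'v \<Rightarrow> real" where "d \<equiv> path_metric R"

section \<open>Stability of the choice from pairs, and betweenness\<close>

lemma pairs_hyper: "{A. A \<subseteq> V \<and> card A = 2} \<subseteq> hyper V"
  unfolding hyper_def by auto

lemma choice:
  assumes "x \<in> V" "y \<in> V" "x \<noteq> y"
  shows "f {x, y} = x \<or> f {x, y} = y"
proof -
  have "\<forall>A\<in>{A. A \<subseteq> V \<and> card A = 2}. f A \<in> A"
    using two_sel unfolding two_selector_def selector_def by blast
  moreover have "{x, y} \<in> {A. A \<subseteq> V \<and> card A = 2}" using assms by simp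
  ultimately have "f {x, y} \<in> {x, y}" by (rule bspec)
  then show ?thesis by blast
qed

text \<open>The pairs \<open>{z, x}\<close> and \<open>{z, y}\<close> are Hausdorff-close when
  \<open>x\<close> and \<open>y\<close> are close, as \<open>z\<close> is matched with itself. The
  bound \<open>s\<close> does not depend on \<open>z\<close>.\<close>

lemma choice_stable:
  "\<exists>s\<ge>0. \<forall>x\<in>V. \<forall>y\<in>V. \<forall>z\<in>V.
    x \<noteq> z \<longrightarrow> y \<noteq> z \<longrightarrow> d x y \<le> r \<longrightarrow> d (f {z, x}) (f {z, y}) \<le> s"
proof -
  let ?G = "{A. A \<subseteq> V \<and> card A = 2}"
  let ?r = "max r 0"
  obtain s where s: "\<And>A B. \<lbrakk>A \<in> ?G; B \<in> ?G; \<forall>a\<in>A. \<exists>b\<in>B. d a b \<le> ?r; \<forall>b\<in>B. \<exists>a\<in>A. d a b \<le> ?r\<rbrakk>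
      \<Longrightarrow> d (f A) (f B) \<le> s"
    using two_sel
    unfolding two_selector_def graph_coarse_def selector_metric_iff[OF pairs_hyper] by meson
  have "d (f {z, x}) (f {z, y}) \<le> max s 0"
    if "x \<in> V" "y \<in> V" "z \<in> V" "x \<noteq> z" "y \<noteq> z" "d x y \<le> r" for x y z
  proof -
    have "d (f {z, x}) (f {z, y}) \<le> s"
    proof (rule s)
      have "d z z \<le> ?r" "d x y \<le> ?r" using that by auto
      then show "\<forall>a\<in>{z, x}. \<exists>b\<in>{z, y}. d a b \<le> ?r" "\<forall>b\<in>{z, y}. \<exists>a\<in>{z, x}. d a b \<le> ?r"
        by blast+
    qed (use that in auto)
    then show ?thesis by simp
  qed
  then show ?thesis by (intro exI[of _ "max s 0"]) auto
qed

text \<open>As long as the walk stays farther than \<open>C\<close> from \<open>z\<close>, the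
  current vertex keeps being chosen over \<open>z\<close>: a switch to \<open>z\<close> would move
  the choice by more than \<open>C\<close>. At the end \<open>z\<close> is chosen over
  \<open>y\<close>, so the walk must have come within \<open>C\<close> of \<open>z\<close>. The
  index \<open>k\<close> records where.\<close>

lemma walk_passes_near:
  assumes stable: "\<forall>x\<in>V. \<forall>y\<in>V. \<forall>z\<in>V.
      x \<noteq> z \<longrightarrow> y \<noteq> z \<longrightarrow> d x y \<le> 1 \<longrightarrow> d (f {z, x}) (f {z, y}) \<le> C" "C \<ge> 0"
    and "(x, y) \<in> R ^^ n" "x \<in> V" "z \<in> V" "y \<in> V" "f {z, x} = x" "f {z, y} = z" "y \<noteq> z" "d z x > C"
  shows "\<exists>p\<in>V. \<exists>k\<le>n. (x, p) \<in> R ^^ k \<and> (p, y) \<in> R ^^ (n - k) \<and> d z p \<le> C"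
  using assms(3-)
proof (induction n arbitrary: x)
  \<comment> \<open>Now \<open>x = y\<close>, which would be both preferred to \<open>z\<close> and
    rejected in favour of it.\<close>
  case 0
  then show ?case by auto
next
  case (Suc n)
  from Suc.prems(1) obtain w where w: "(x, w) \<in> R" "(w, y) \<in> R ^^ n" by (rule relpow_Suc_E2)
  have wV: "w \<in> V" using w(1) graph unfolding simple_graph_def by blast
  show ?case
  proof (cases "d z w \<le> C")
    case True
    then show ?thesis using w wV by (intro bexI[of _ w] exI[of _ 1]) auto
  next
    case False
    have xz: "x \<noteq> z" and wz: "w \<noteq> z"
      using Suc.prems \<open>C \<ge> 0\<close> False by auto
    have "d x w \<le> 1" using path_metric_le_of_relpow[where x = x and y = w and n = 1] w(1) by simp
    \<comment> \<open>The choice from \<open>{z, x}\<close> is \<open>x\<close>, so the next choice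
      is within \<open>C\<close> of \<open>x\<close>; since \<open>z\<close> is farther away, it
      cannot be \<open>z\<close>.\<close>
    then have "d x (f {z, w}) \<le> C"
      using stable(1)[rule_format, of x w z] Suc.prems xz wz wV by simp
    then have "f {z, w} \<noteq> z" using Suc.prems commute[of x z] by auto
    then have "f {z, w} = w" using choice[OF \<open>z \<in> V\<close> wV] wz by blast
    then obtain p k where "p \<in> V" "k \<le> n" "(w, p) \<in> R ^^ k" "(p, y) \<in> R ^^ (n - k)" "d z p \<le> C"
      using Suc.IH[of w] w(2) wV Suc.prems False by auto
    moreover from this have "(x, p) \<in> R ^^ Suc k" using w(1) by (intro relpow_Suc_I2)
    ultimately show ?thesis by (intro bexI[of _ p] exI[of _ "Suc k"]) auto
  qed
qed

text \<open>A geodesic from \<open>x\<close> to \<open>y\<close> has a point \<open>p\<close> within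
  \<open>C\<close> of \<open>z\<close>. Detours from \<open>p\<close> to \<open>z\<close> in the two
  triangle inequalities account for \<open>2 * C\<close>.\<close>

lemma between:
  assumes stable: "\<forall>x\<in>V. \<forall>y\<in>V. \<forall>z\<in>V.
      x \<noteq> z \<longrightarrow> y \<noteq> z \<longrightarrow> d x y \<le> 1 \<longrightarrow> d (f {z, x}) (f {z, y}) \<le> C" "C \<ge> 0"
    and V: "x \<in> V" "z \<in> V" "y \<in> V" and "f {z, x} = x" "f {z, y} = z" "y \<noteq> z" "d z x > C"
  shows "d x z + d z y \<le> d x y + 2 * C"
proof -
  obtain n where n: "(x, y) \<in> R ^^ n" "d x y = real n"
    using connected_graph_geodesic[OF connected V(1,3)] .
  obtain p k where p: "p \<in> V" "k \<le> n" "(x, p) \<in> R ^^ k" "(p, y) \<in> R ^^ (n - k)" "d z p \<le> C"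
    using walk_passes_near[OF stable n(1) V assms(6-)] by blast
  have "d x p + d p y \<le> d x y"
    using path_metric_le_of_relpow[OF p(3)] path_metric_le_of_relpow[OF p(4)] n(2) p(2) by simp
  moreover have "d x z \<le> d x p + d z p" "d z y \<le> d z p + d p y"
    using triangle[OF V(1) p(1) V(2)] triangle[OF V(2) p(1) V(3)] commute[of p z] by auto
  ultimately show ?thesis using p(5) by linarith
qed

text \<open>Signed distance from \<open>v\<close>, positive on points that \<open>v\<close>
  precedes. The distance is written with \<open>LEAST\<close> to obtain an integer. At
  \<open>x = v\<close> the sign is that of an arbitrary value of \<open>f\<close> on a singleton,
  but the distance is 0.\<close>

definition coordinate :: "'v \<Rightarrow> 'v \<Rightarrow> int" where
  "coordinate v x = (if f {v, x} = v then 1 else - 1) * int (LEAST n. (v, x) \<in> R ^^ n)"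

lemma of_int_coordinate:
  "real_of_int (coordinate v x) = (if f {v, x} = v then d v x else - d v x)"
  by (simp add: coordinate_def path_metric_def)

text \<open>For equal signs the triangle inequality suffices. For opposite signs one choice is
  \<open>v\<close> and the other is the moving point, so stability puts that point within
  \<open>s\<close> of \<open>v\<close> and the other one within \<open>s + r\<close>.\<close>

lemma bornologous_coordinate:
  assumes v: "v \<in> V"
  shows "bornologous_on V d (\<lambda>a b. \<bar>of_int a - of_int b\<bar>) (coordinate v)"
  unfolding bornologous_on_def
proof
  fix r
  obtain s where nonneg_s: "s \<ge> 0" and stable: "\<forall>x\<in>V. \<forall>y\<in>V. \<forall>z\<in>V.
      x \<noteq> z \<longrightarrow> y \<noteq> z \<longrightarrow> d x y \<le> r \<longrightarrow> d (f {z, x}) (f {z, y}) \<le> s"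
    using choice_stable[of r] by (elim exE conjE) (rule that)
  note s = nonneg_s stable[rule_format]
  have le: "\<bar>real_of_int (coordinate v x) - of_int (coordinate v y)\<bar> \<le> 2 * s + r"
    if V: "x \<in> V" "y \<in> V" "d x y \<le> r" for x y
  proof -
    have r: "r \<ge> 0" using V nonneg[of x y] by linarith
    have tri: "d v x \<le> d v y + r" "d v y \<le> d v x + r"
      using triangle[OF v V(1,2)] triangle[OF v V(2,1)] commute[of x y] V(3) by auto
    \<comment> \<open>Stability concerns points other than \<open>v\<close>. If one point is
      \<open>v\<close>, its coordinate is 0 and that of the other has absolute value at most
      \<open>r\<close>.\<close>
    consider "x = v" | "y = v" | "x \<noteq> v" "y \<noteq> v" "(f {v, x} = v) = (f {v, y} = v)"
      | "x \<noteq> v" "y \<noteq> v" "f {v, x} = v" "f {v, y} \<noteq> v"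
      | "x \<noteq> v" "y \<noteq> v" "f {v, x} \<noteq> v" "f {v, y} = v" by blast
    then show ?thesis
    proof cases
      case 1
      then show ?thesis using V s(1) v by (auto simp: of_int_coordinate)
    next
      case 2
      then show ?thesis using V s(1) v commute[of x v] by (auto simp: of_int_coordinate)
    next
      case 3
      then show ?thesis using tri s(1) by (auto simp: of_int_coordinate)
    next
      case 4
      then have "f {v, y} = y" using choice[OF v V(2)] by blast
      then have "d v y \<le> s" using s(2)[OF V(1,2) v] 4 V(3) by simp
      then show ?thesis
        using tri r nonneg[of v x] nonneg[of v y] 4 by (simp add: of_int_coordinate del: nonneg)
    next
      case 5
      then have "f {v, x} = x" using choice[OF v V(1)] by blast
      then have "d v x \<le> s" using s(2)[OF V(1,2) v] 5 V(3) commute[of x v] by simp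
      then show ?thesis
        using tri r nonneg[of v x] nonneg[of v y] 5 by (simp add: of_int_coordinate del: nonneg)
    qed
  qed
  then show "\<exists>s. \<forall>x\<in>V. \<forall>y\<in>V. d x y \<le> r \<longrightarrow>
      \<bar>real_of_int (coordinate v x) - of_int (coordinate v y)\<bar> \<le> s" by blast
qed

text \<open>If \<open>x\<close> and \<open>y\<close> are on the same side of \<open>v\<close>, one
  of them lies between \<open>v\<close> and the other, and \<open>between\<close> bounds
  \<open>d x y\<close> by the difference of the coordinates plus \<open>2 * C\<close>. On opposite
  sides that difference is \<open>d v x + d v y\<close>.\<close>

lemma effectively_proper_coordinate:
  assumes v: "v \<in> V"
  shows "effectively_proper_on V d (\<lambda>a b. \<bar>of_int a - of_int b\<bar>) (coordinate v)"
  unfolding effectively_proper_on_def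
proof
  fix r
  obtain C where nonneg_C: "C \<ge> 0" and stable: "\<forall>x\<in>V. \<forall>y\<in>V. \<forall>z\<in>V.
      x \<noteq> z \<longrightarrow> y \<noteq> z \<longrightarrow> d x y \<le> 1 \<longrightarrow> d (f {z, x}) (f {z, y}) \<le> C"
    using choice_stable[of 1] by (elim exE conjE) (rule that)
  note C = nonneg_C stable[rule_format]
  note between = between[OF stable nonneg_C]
  have ordered: "d x y \<le> r + 2 * C"
    if V: "x \<in> V" "y \<in> V" and "f {x, y} = x"
      and close: "\<bar>real_of_int (coordinate v x) - of_int (coordinate v y)\<bar> \<le> r" for x y
  \<comment> \<open>The cases split off violate a distinctness or distance condition of
    \<open>between\<close>. If \<open>d v x \<le> C\<close>, then \<open>d v y \<le> C + r\<close>,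
    and the triangle inequality through \<open>v\<close> gives the same bound.\<close>
  proof (cases "x = v \<or> y = v \<or> x = y \<or> d x y \<le> C \<or> d v x \<le> C")
    case True
    have "r \<ge> 0" using close by linarith
    moreover have "d x y \<le> d v x + d v y" using triangle[OF V(1) v V(2)] commute[of v x] by simp
    moreover have "\<bar>d v x - d v y\<bar> \<le> r"
      using close nonneg[of v x] nonneg[of v y]
      by (auto simp: of_int_coordinate simp del: nonneg split: if_splits)
    ultimately show ?thesis using True C(1) v V commute[of x v] by auto
  next
    case False
    consider "f {v, x} = v" "f {v, y} = v" | "f {v, x} \<noteq> v" "f {v, y} \<noteq> v"
      | "(f {v, x} = v) \<noteq> (f {v, y} = v)" by blast
    then show ?thesis
    proof cases
      case 1
      \<comment> \<open>Here \<open>v\<close> precedes \<open>x\<close> and \<open>x\<close>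
        precedes \<open>y\<close>, so \<open>x\<close> is the middle point.\<close>
      have "f {x, v} = v" using 1(1) by (simp add: insert_commute)
      moreover have "f {x, y} = x" "y \<noteq> x" "d x v > C" using that(3) False commute[of x v] by auto
      ultimately have "d v x + d x y \<le> d v y + 2 * C" by (rule between[OF v V])
      then show ?thesis using close 1 by (auto simp: of_int_coordinate)
    next
      case 2
      \<comment> \<open>Here \<open>x\<close> precedes \<open>y\<close> and \<open>y\<close>
        precedes \<open>v\<close>, so \<open>y\<close> is the middle point.\<close>
      have "f {v, y} = y" using choice[OF v V(2)] 2 False by blast
      then have "f {y, v} = y" by (simp add: insert_commute)
      moreover have "f {y, x} = x" using that(3) by (simp add: insert_commute)
      moreover have "v \<noteq> y" "d y x > C" using False commute[of x y] by auto
      ultimately have "d x y + d y v \<le> d x v + 2 * C" by (intro between[OF V v])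
      then show ?thesis using close 2 commute[of x v] commute[of y v] by (auto simp: of_int_coordinate)
    next
      case 3
      have "d x y \<le> d v x + d v y" using triangle[OF V(1) v V(2)] commute[of v x] by simp
      then show ?thesis using close 3 C(1) by (auto simp: of_int_coordinate split: if_splits)
    qed
  qed
  \<comment> \<open>One of two distinct points precedes the other, and the claim is symmetric in
    them.\<close>
  have "d x y \<le> r + 2 * C"
    if V: "x \<in> V" "y \<in> V"
      and close: "\<bar>real_of_int (coordinate v x) - of_int (coordinate v y)\<bar> \<le> r" for x y
  proof (cases "x = y")
    case True
    then show ?thesis using close C(1) V by simp
  next
    case False
    then consider "f {x, y} = x" | "f {y, x} = y" using choice[OF V] by (metis insert_commute)
    then show ?thesis
      using ordered[OF V] ordered[OF V(2,1)] close commute[of x y] by cases (auto simp: abs_minus_commute)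
  qed
  then show "\<exists>s. \<forall>x\<in>V. \<forall>y\<in>V.
      \<bar>real_of_int (coordinate v x) - of_int (coordinate v y)\<bar> \<le> r \<longrightarrow> d x y \<le> s" by blast
qed

end

section \<open>Line-like graphs\<close>

text \<open>A discrete intermediate value argument: the vertex just before the walk first rises
  above \<open>n\<close> is within \<open>K\<close> of \<open>n\<close>, and if the walk never does,
  its end has value \<open>n\<close>. The witness is only claimed to be reachable; membership in the
  vertex set is derived afterwards.\<close>

lemma walk_meets_near:
  fixes h :: "'v \<Rightarrow> int"
  assumes step: "\<And>x y. (x, y) \<in> R \<Longrightarrow> \<bar>h x - h y\<bar> \<le> K" and "K \<ge> 0"
    and "(x, y) \<in> R ^^ m" "h x \<le> n" "n \<le> h y"
  shows "\<exists>z. (x, z) \<in> R\<^sup>* \<and> \<bar>h z - n\<bar> \<le> K"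
  using assms(3-)
proof (induction m arbitrary: x)
  case 0
  then show ?case using \<open>K \<ge> 0\<close> by auto
next
  case (Suc m)
  from Suc.prems(1) obtain w where w: "(x, w) \<in> R" "(w, y) \<in> R ^^ m" by (rule relpow_Suc_E2)
  show ?case
  proof (cases "h w \<le> n")
    case True
    then show ?thesis using Suc w by (meson converse_rtrancl_into_rtrancl)
  next
    case False
    then have "\<bar>h x - n\<bar> \<le> K" using step[OF w(1)] Suc.prems by linarith
    then show ?thesis by blast
  qed
qed

lemma bornologous_image_dense:
  fixes h :: "'v \<Rightarrow> int"
  assumes graph: "simple_graph V R" "connected_graph V R"
    and b: "bornologous_on V (path_metric R) (\<lambda>a b. \<bar>of_int a - of_int b\<bar>) h"
  obtains K where "K \<ge> 0"
    "\<And>x y n. \<lbrakk>x \<in> V; y \<in> V; h x \<le> n; n \<le> h y\<rbrakk> \<Longrightarrow> \<exists>z\<in>V. \<bar>h z - n\<bar> \<le> K"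
proof -
  have RV: "R \<subseteq> V \<times> V" using graph(1) unfolding simple_graph_def by blast
  obtain s where s: "\<And>x y. x \<in> V \<Longrightarrow> y \<in> V \<Longrightarrow> path_metric R x y \<le> 1 \<Longrightarrow>
      \<bar>real_of_int (h x) - of_int (h y)\<bar> \<le> s"
    using b unfolding bornologous_on_def by blast
  \<comment> \<open>The bound \<open>s\<close> is a real of unknown sign; \<open>K\<close> has to be
    a nonnegative integer.\<close>
  define K where "K = \<bar>\<lceil>s\<rceil>\<bar>"
  have step: "\<bar>h x - h y\<bar> \<le> K" if "(x, y) \<in> R" for x y
  proof -
    have "path_metric R x y \<le> 1" using path_metric_le_of_relpow[where x = x and y = y and n = 1] that by simp
    then have "\<bar>real_of_int (h x) - of_int (h y)\<bar> \<le> s" using s that RV by blast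
    then show ?thesis unfolding K_def by linarith
  qed
  have "\<exists>z\<in>V. \<bar>h z - n\<bar> \<le> K" if xy: "x \<in> V" "y \<in> V" "h x \<le> n" "n \<le> h y" for x y n
  proof -
    obtain m where "(x, y) \<in> R ^^ m" using connected_graph_geodesic[OF graph(2) xy(1,2)] .
    then obtain z where z: "(x, z) \<in> R\<^sup>*" "\<bar>h z - n\<bar> \<le> K"
      using walk_meets_near[of R h K, OF step _ _ xy(3,4)] unfolding K_def by auto
    from z(1) have "z \<in> V" using xy(1) RV by (induction rule: rtrancl_induct) auto
    then show ?thesis using z(2) by blast
  qed
  then show thesis by (intro that[of K]) (auto simp: K_def)
qed

text \<open>Subtracting the lower bound \<open>m\<close> keeps differences and makes the values
  natural numbers. Connectedness leaves only bounded gaps in the image.\<close>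

lemma coarsely_equivalent_nat_if_bounded_below:
  fixes h :: "'v \<Rightarrow> int"
  assumes graph: "simple_graph V R" "connected_graph V R"
    and b: "bornologous_on V (path_metric R) (\<lambda>a b. \<bar>of_int a - of_int b\<bar>) h"
    and p: "effectively_proper_on V (path_metric R) (\<lambda>a b. \<bar>of_int a - of_int b\<bar>) h"
    and lower: "\<And>x. x \<in> V \<Longrightarrow> m \<le> h x" and upper: "\<And>n. \<exists>x\<in>V. n < h x"
  shows "coarsely_equivalent V (graph_coarse V R) (UNIV :: nat set) (graph_coarse UNIV nat_adj)"
  unfolding graph_coarse_nat unfolding graph_coarse_def
proof -
  obtain K where K: "K \<ge> 0"
    "\<And>x y n. \<lbrakk>x \<in> V; y \<in> V; h x \<le> n; n \<le> h y\<rbrakk> \<Longrightarrow> \<exists>z\<in>V. \<bar>h z - n\<bar> \<le> K"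
    using bornologous_image_dense[OF graph b] by blast
  define g where "g = (\<lambda>x. nat (h x - m))"
  have g: "\<bar>real (g x) - real (g y)\<bar> = \<bar>of_int (h x) - of_int (h y)\<bar>" if "x \<in> V" "y \<in> V" for x y
    using lower[OF that(1)] lower[OF that(2)] by (simp add: g_def)
  obtain v where v: "v \<in> V" using upper by blast
  show "coarsely_equivalent V (metric_coarse V (path_metric R))
      (UNIV :: nat set) (metric_coarse UNIV (\<lambda>a b. \<bar>real a - real b\<bar>))"
  proof (rule coarsely_equivalent_metricI[OF Metric_space_path_metric[OF graph] Metric_space_nat])
    show "bornologous_on V (path_metric R) (\<lambda>a b. \<bar>real a - real b\<bar>) g"
      using b g unfolding bornologous_on_def by (metis (no_types, lifting))
    show "effectively_proper_on V (path_metric R) (\<lambda>a b. \<bar>real a - real b\<bar>) g"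
      using p g unfolding effectively_proper_on_def by (metis (no_types, lifting))
    fix n :: nat
    \<comment> \<open>From \<open>h v\<close> upwards the gaps are bounded by \<open>K\<close>. A
      target below \<open>h v\<close> is at least \<open>m\<close>, hence within
      \<open>h v - m\<close> of \<open>h v\<close>.\<close>
    have "\<exists>z\<in>V. \<bar>h z - (int n + m)\<bar> \<le> K + (h v - m)"
    proof (cases "h v \<le> int n + m")
      case True
      obtain y where "y \<in> V" "int n + m < h y" using upper by blast
      then obtain z where "z \<in> V" "\<bar>h z - (int n + m)\<bar> \<le> K" using K(2)[OF v _ True] by (meson less_imp_le)
      then show ?thesis using lower[OF v] by (intro bexI[of _ z]) auto
    next
      case False
      then show ?thesis using v K(1) by (intro bexI[of _ v]) auto
    qed
    then obtain z where z: "z \<in> V" "\<bar>h z - (int n + m)\<bar> \<le> K + (h v - m)" by blast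
    have "\<bar>int (g z) - int n\<bar> \<le> K + (h v - m)" using z(2) lower[OF z(1)] by (simp add: g_def)
    then have "\<bar>real (g z) - real n\<bar> \<le> of_int (K + (h v - m))" by linarith
    then show "\<exists>x\<in>V. \<bar>real (g x) - real n\<bar> \<le> of_int (K + (h v - m))" using z(1) by blast
  qed simp
qed

lemma coarsely_equivalent_int_if_unbounded:
  fixes h :: "'v \<Rightarrow> int"
  assumes graph: "simple_graph V R" "connected_graph V R"
    and b: "bornologous_on V (path_metric R) (\<lambda>a b. \<bar>of_int a - of_int b\<bar>) h"
    and p: "effectively_proper_on V (path_metric R) (\<lambda>a b. \<bar>of_int a - of_int b\<bar>) h"
    and lower: "\<And>n. \<exists>x\<in>V. h x < n" and upper: "\<And>n. \<exists>x\<in>V. n < h x"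
  shows "coarsely_equivalent V (graph_coarse V R) (UNIV :: int set) (graph_coarse UNIV int_adj)"
  unfolding graph_coarse_int unfolding graph_coarse_def
proof -
  obtain K where K:
    "\<And>x y n. \<lbrakk>x \<in> V; y \<in> V; h x \<le> n; n \<le> h y\<rbrakk> \<Longrightarrow> \<exists>z\<in>V. \<bar>h z - n\<bar> \<le> K"
    using bornologous_image_dense[OF graph b] by blast
  show "coarsely_equivalent V (metric_coarse V (path_metric R))
      (UNIV :: int set) (metric_coarse UNIV (\<lambda>a b. \<bar>of_int a - of_int b\<bar>))"
  proof (rule coarsely_equivalent_metricI[OF Metric_space_path_metric[OF graph] Metric_space_int _ b p])
    fix n :: int
    obtain x y where "x \<in> V" "h x < n" "y \<in> V" "n < h y" using lower upper by metis
    then obtain z where z: "z \<in> V" "\<bar>h z - n\<bar> \<le> K" using K[of x y n] by auto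
    then have "\<bar>real_of_int (h z) - of_int n\<bar> \<le> of_int K" by linarith
    then show "\<exists>x\<in>V. \<bar>real_of_int (h x) - of_int n\<bar> \<le> of_int K" using z(1) by blast
  qed simp
qed

text \<open>The four cases are whether the coordinate is bounded below and whether it is bounded
  above.\<close>

lemma (in two_selector_graph) line_like:
  assumes "locally_finite_graph V R"
  shows "finite V \<or>
    coarsely_equivalent V (graph_coarse V R) (UNIV :: nat set) (graph_coarse UNIV nat_adj) \<or>
    coarsely_equivalent V (graph_coarse V R) (UNIV :: int set) (graph_coarse UNIV int_adj)"
proof (cases "V = {}")
  case False
  then obtain v where v: "v \<in> V" by blast
  let ?h = "coordinate v" and ?k = "\<lambda>x. - coordinate v x"
  note h = bornologous_coordinate[OF v] effectively_proper_coordinate[OF v]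
  have abs_k: "\<bar>real_of_int (?k x) - of_int (?k y)\<bar> = \<bar>of_int (?h x) - of_int (?h y)\<bar>" for x y
    by simp
  have k: "bornologous_on V d (\<lambda>a b. \<bar>of_int a - of_int b\<bar>) ?k"
    "effectively_proper_on V d (\<lambda>a b. \<bar>of_int a - of_int b\<bar>) ?k"
    using h unfolding bornologous_on_def effectively_proper_on_def abs_k .
  have "(\<exists>n. \<forall>x\<in>V. ?h x \<le> n) \<or> (\<forall>n. \<exists>x\<in>V. n < ?h x)"
    "(\<exists>m. \<forall>x\<in>V. m \<le> ?h x) \<or> (\<forall>m. \<exists>x\<in>V. ?h x < m)"
    by (meson not_le)+
  then consider (low_up) m n where "\<And>x. x \<in> V \<Longrightarrow> m \<le> ?h x" "\<And>x. x \<in> V \<Longrightarrow> ?h x \<le> n"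
    | (low) m where "\<And>x. x \<in> V \<Longrightarrow> m \<le> ?h x" "\<And>n. \<exists>x\<in>V. n < ?h x"
    | (up) n where "\<And>x. x \<in> V \<Longrightarrow> ?h x \<le> n" "\<And>m. \<exists>x\<in>V. ?h x < m"
    | (none) "\<And>n. \<exists>x\<in>V. n < ?h x" "\<And>m. \<exists>x\<in>V. ?h x < m"
    by metis
  then show ?thesis
  proof cases
    case low_up
    have "d v x \<le> of_int (max \<bar>m\<bar> \<bar>n\<bar>)" if x: "x \<in> V" for x
    proof -
      have "\<bar>?h x\<bar> \<le> max \<bar>m\<bar> \<bar>n\<bar>" using low_up[OF x] by linarith
      moreover have "d v x = of_int \<bar>?h x\<bar>" using nonneg[of v x] by (simp add: of_int_coordinate)
      ultimately show ?thesis by (simp only: of_int_le_iff)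
    qed
    \<comment> \<open>Bounds on both sides make \<open>V\<close> a ball about \<open>v\<close>,
      which is finite by local finiteness.\<close>
    then have "V = {x \<in> V. d v x \<le> of_int (max \<bar>m\<bar> \<bar>n\<bar>)}" by blast
    then show ?thesis
      using locally_finite_graph_finite_ball[OF graph connected assms v] by metis
  next
    case low
    then show ?thesis using coarsely_equivalent_nat_if_bounded_below[OF graph connected h] by blast
  next
    case up
    \<comment> \<open>Reversing the sign reduces this case to a coordinate bounded below and
      unbounded above.\<close>
    have "- n \<le> ?k x" if "x \<in> V" for x using up(1)[OF that] by simp
    moreover have "\<exists>x\<in>V. m < ?k x" for m
    proof -
      obtain x where "x \<in> V" "?h x < - m" using up(2) by blast
      then show ?thesis by (intro bexI[of _ x]) auto
    qed
    ultimately show ?thesis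
      using coarsely_equivalent_nat_if_bounded_below[OF graph connected k] by blast
  next
    case none
    then show ?thesis using coarsely_equivalent_int_if_unbounded[OF graph connected h] by blast
  qed
qed simp

text \<open>All three alternatives reduce to one kind of data, a coarse embedding into the integers;
  \<open>\<nat>\<close> sits isometrically inside \<open>\<int>\<close>.\<close>

lemma line_like_embeds_int:
  fixes V :: "'v set"
  assumes "simple_graph V R" "connected_graph V R"
    and "finite V \<or>
      coarsely_equivalent V (graph_coarse V R) (UNIV :: nat set) (graph_coarse UNIV nat_adj) \<or>
      coarsely_equivalent V (graph_coarse V R) (UNIV :: int set) (graph_coarse UNIV int_adj)"
  obtains h :: "'v \<Rightarrow> int" where
    "bornologous_on V (path_metric R) (\<lambda>a b. \<bar>of_int a - of_int b\<bar>) h"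
    "effectively_proper_on V (path_metric R) (\<lambda>a b. \<bar>of_int a - of_int b\<bar>) h"
proof -
  note metric = Metric_space_path_metric[OF assms(1,2)]
  from assms(3) consider "finite V"
    | "coarsely_equivalent V (metric_coarse V (path_metric R))
        (UNIV :: nat set) (metric_coarse UNIV (\<lambda>a b. \<bar>real a - real b\<bar>))"
    | "coarsely_equivalent V (metric_coarse V (path_metric R))
        (UNIV :: int set) (metric_coarse UNIV (\<lambda>a b. \<bar>of_int a - of_int b\<bar>))"
    unfolding graph_coarse_nat graph_coarse_int unfolding graph_coarse_def by blast
  then show thesis
  proof cases
    case 1
    let ?D = "(\<lambda>(x, y). path_metric R x y) ` (V \<times> V)"
    have "finite ?D" using 1 by blast
    then have "path_metric R x y \<le> Max ?D" if "x \<in> V" "y \<in> V" for x y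
      using that by (intro Max_ge) auto
    then show thesis
      \<comment> \<open>A constant map is effectively proper here because all distances in
        \<open>V\<close> are bounded by \<open>Max ?D\<close>.\<close>
      by (intro that[of "\<lambda>_. 0"]) (auto simp: bornologous_on_def effectively_proper_on_def)
  next
    case 2
    then obtain g where "bornologous_on V (path_metric R) (\<lambda>a b. \<bar>real a - real b\<bar>) g"
      "effectively_proper_on V (path_metric R) (\<lambda>a b. \<bar>real a - real b\<bar>) g"
      by (rule coarsely_equivalent_metricE[OF metric Metric_space_nat])
    then show thesis
      by (intro that[of "\<lambda>x. int (g x)"]) (simp_all add: bornologous_on_def effectively_proper_on_def)
  next
    case 3
    then show thesis
      by (rule coarsely_equivalent_metricE[OF metric Metric_space_int]) (rule that)
  qed
qed

theorem theorem2:
  fixes V :: "'v set" and R :: "('v \<times> 'v) set"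
  assumes "simple_graph V R"
    and "connected_graph V R"
    and "locally_finite_graph V R"
  shows "((\<exists>f. finitary_selector V (graph_coarse V R) f) \<longleftrightarrow>
          (\<exists>f. two_selector V (graph_coarse V R) f)) \<and>
         ((\<exists>f. two_selector V (graph_coarse V R) f) \<longleftrightarrow>
          (finite V \<or>
           coarsely_equivalent V (graph_coarse V R) (UNIV :: nat set) (graph_coarse UNIV nat_adj) \<or>
           coarsely_equivalent V (graph_coarse V R) (UNIV :: int set) (graph_coarse UNIV int_adj)))"
    (is "(?i \<longleftrightarrow> ?ii) \<and> (?ii \<longleftrightarrow> ?iii)")
proof -
  note metric = Metric_space_path_metric[OF assms(1,2)]
  have "?ii" if "?i"
    using that two_selector_if_finitary_selector[OF metric] unfolding graph_coarse_def by blast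
  moreover have "?iii" if "?ii"
  proof -
    from that obtain f where f: "two_selector V (graph_coarse V R) f" ..
    interpret two_selector_graph V R f using assms(1,2) f by unfold_locales
    show ?thesis using assms(3) by (rule line_like)
  qed
  moreover have "?i" if iii: "?iii"
  proof (rule line_like_embeds_int[OF assms(1,2) iii])
    fix h :: "'v \<Rightarrow> int"
    assume "bornologous_on V (path_metric R) (\<lambda>a b. \<bar>of_int a - of_int b\<bar>) h"
      "effectively_proper_on V (path_metric R) (\<lambda>a b. \<bar>of_int a - of_int b\<bar>) h"
    then show "?i" using finitary_selector_if_embeds_int[OF metric] unfolding graph_coarse_def by blast
  qed
  ultimately show ?thesis by blast
qed

end
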